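(* Let $N\ge 4$ and $s\ge 1$ be integers, and let $\chi_\alpha$ be the character of the irreducible corepresentation $r_\alpha$ of $C(H_N^{s+})$ indexed by $\alpha=a^{l_1}z^{j_1}\cdots z^{j_{k-1}}a^{l_k}\in S$. Let $\pi:C(H_N^{s+})\to C(S_N^+)$ be the canonical morphism. Then, identifying $C(S_N^+)_0$ with $C([0,N])$, the image $P_\alpha=\pi(\chi_\alpha)$ satisfies $$P_\alpha(X^2)=\pi(\chi_\alpha)(X^2)=\prod_{i=1}^k A_{l_i}(X).$$
   Context: Polynomials: $(A_t)_{t\in\mathbb{N}}$ is defined by $A_0=1$, $A_1=X$, and $A_1A_t=A_{t+1}+A_{t-1}$ for $t\ge 1$. Quantum reflection groups: $C(H_N^{s+})$ is the universal unital $C^*$-algebra generated by $N^2$ normal elements $U_{ij}$ such that $U=(U_{ij})$ and ${}^tU=(U_{ji})$ are unitary, $p_{ij}=U_{ij}U_{ij}^*$ is a projection and $U_{ij}^s=p_{ij}$, with coproduct $\Delta(U_{ij})=\sum_kU_{ik}\otimes U_{kj}$. Quantum permutation group $S_N^+$ (the case $s=1$): $C(S_N^+)$ is the universal unital $C^*$-algebra generated by $N^2$ elements $v_{ij}$ such that $v=(v_{ij})$ and ${}^tv=(v_{ji})$ are unitary and $v_{ij}=v_{ij}^*=v_{ij}^2$, with $\Delta(v_{ij})=\sum_k v_{ik}\otimes v_{kj}$. The canonical morphism $\pi$ is the $*$-homomorphism with $\pi(U_{ij})=v_{ij}$; it is a morphism of compact quantum groups. For a compact quantum group $\mathbb{G}$,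 the character of a corepresentation $u=(u_{ij})$ is $\sum_i u_{ii}$, and $C(\mathbb{G})_0\subset C(\mathbb{G})$ is the $C^*$-algebra generated by the characters of irreducible corepresentations. For $N\ge4$ there is a $*$-isomorphism $C(S_N^+)_0\simeq C([0,N])$ sending $\chi=\sum_i v_{ii}$ to the identity function $X$; this is the identification used. Irreducible corepresentations of $C(H_N^{s+})$ (known, Banica–Vergnioux): Set $U_k=(U_{ij}^k)$ for $k>0$, extended to $k\in\mathbb{Z}$ by $U_{k+s}=U_k$ (so $U_0=(U_{ij}U_{ij}^* )$), $\rho_t=U_t$ for $1\le t\le s-1$, and $\rho_0=U_0\ominus 1$. Let $M=\langle a,z: z^s=1\rangle$ be the monoid with involution $a^*=a$, $z^*=z^{-1}$, and fusion rules obtained recursively from $$vaz^i\otimes z^jaw=vaz^{i+j}aw\oplus\delta_{i+j,0}(v\otimes w),$$ where exponents of $z$ are taken modulo $s$ and $1$ is a unit for $\otimes$. The irreducible corepresentations of $C(H_N^{s+})$ are, up to equivalence, indexed bijectively as $r_\alpha$ by the elements $\alpha$ of the submonoid $S\subset M$ generated by $az^ia$, $i=0,\dots,s-1$, with these involution (conjugation) and fusion rules (tensor products); $r_1$ is trivial, $r_{a^2}=\rho_0$, and $r_{az^ta}=\rho_t$ for $1\le t\le s-1$. Every $\alpha\in S\setminus\{1\}$ is uniquely written $\alpha=a^{l_1}z^{j_1}\cdots z^{j_{k-1}}a^{l_k}$ with $l_i>0$, $1\le j_i\le s-1$, where if $k=1$ then $l_1$ is even, and if $k\ge2$ then $l_1,l_k$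 are odd and $l_2,\dots,l_{k-1}$ are even. For $\alpha=1$ the product is empty (equal to $1$). *)

theory Defs
  imports
    "HOL-Analysis.Analysis"
    "HOL-Algebra.Ring"
    "Jordan_Normal_Form.Matrix"
begin

section \<open>The polynomials \<open>A\<^sub>t\<close>\<close>

fun A_poly :: "nat \<Rightarrow> real poly" where
  "A_poly 0 = 1"
| "A_poly (Suc 0) = [:0, 1:]"
| "A_poly (Suc (Suc t)) = A_poly (Suc 0) * A_poly (Suc t) - A_poly t"

section \<open>Unital C*-algebras\<close>

record 'a cstar_alg = "'a ring" +
  scal :: "complex \<Rightarrow> 'a \<Rightarrow> 'a"
  star :: "'a \<Rightarrow> 'a"
  nrm :: "'a \<Rightarrow> real"

definition nrm_tendsto :: "('a, 'm) cstar_alg_scheme \<Rightarrow> (nat \<Rightarrow> 'a) \<Rightarrow> 'a \<Rightarrow> bool" where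
  "nrm_tendsto A X x \<longleftrightarrow> (\<lambda>n. nrm A (X n \<ominus>\<^bsub>A\<^esub> x)) \<longlonglongrightarrow> 0"

definition nrm_Cauchy :: "('a, 'm) cstar_alg_scheme \<Rightarrow> (nat \<Rightarrow> 'a) \<Rightarrow> bool" where
  "nrm_Cauchy A X \<longleftrightarrow>
     (\<forall>e>0. \<exists>n\<^sub>0. \<forall>m\<ge>n\<^sub>0. \<forall>n\<ge>n\<^sub>0. nrm A (X m \<ominus>\<^bsub>A\<^esub> X n) < e)"

text \<open>
  The zero algebra is excluded. The underlying type of a C*-algebra therefore has at least the
  cardinality of the continuum; this is used in the remark on \<open>universal_cstar\<close> below.
\<close>

locale unital_cstar_algebra = ring A for A :: "('a, 'm) cstar_alg_scheme" (structure) +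
  assumes one_neq_zero: "\<one> \<noteq> \<zero>"
    and scal_closed: "x \<in> carrier A \<Longrightarrow> scal A c x \<in> carrier A"
    and scal_add_left: "x \<in> carrier A \<Longrightarrow> scal A (c + d) x = scal A c x \<oplus> scal A d x"
    and scal_add_right:
      "\<lbrakk>x \<in> carrier A; y \<in> carrier A\<rbrakk> \<Longrightarrow> scal A c (x \<oplus> y) = scal A c x \<oplus> scal A c y"
    and scal_scal: "x \<in> carrier A \<Longrightarrow> scal A c (scal A d x) = scal A (c * d) x"
    and scal_one: "x \<in> carrier A \<Longrightarrow> scal A 1 x = x"
    and scal_mult_left:
      "\<lbrakk>x \<in> carrier A; y \<in> carrier A\<rbrakk> \<Longrightarrow> scal A c x \<otimes> y = scal A c (x \<otimes> y)"
    and scal_mult_right: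
      "\<lbrakk>x \<in> carrier A; y \<in> carrier A\<rbrakk> \<Longrightarrow> x \<otimes> scal A c y = scal A c (x \<otimes> y)"
    and star_closed: "x \<in> carrier A \<Longrightarrow> star A x \<in> carrier A"
    and star_star: "x \<in> carrier A \<Longrightarrow> star A (star A x) = x"
    and star_add:
      "\<lbrakk>x \<in> carrier A; y \<in> carrier A\<rbrakk> \<Longrightarrow> star A (x \<oplus> y) = star A x \<oplus> star A y"
    and star_scal: "x \<in> carrier A \<Longrightarrow> star A (scal A c x) = scal A (cnj c) (star A x)"
    and star_mult:
      "\<lbrakk>x \<in> carrier A; y \<in> carrier A\<rbrakk> \<Longrightarrow> star A (x \<otimes> y) = star A y \<otimes> star A x"
    and nrm_eq_0_iff: "x \<in> carrier A \<Longrightarrow> nrm A x = 0 \<longleftrightarrow> x = \<zero>"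
    and nrm_triangle:
      "\<lbrakk>x \<in> carrier A; y \<in> carrier A\<rbrakk> \<Longrightarrow> nrm A (x \<oplus> y) \<le> nrm A x + nrm A y"
    and nrm_scal: "x \<in> carrier A \<Longrightarrow> nrm A (scal A c x) = cmod c * nrm A x"
    and nrm_mult:
      "\<lbrakk>x \<in> carrier A; y \<in> carrier A\<rbrakk> \<Longrightarrow> nrm A (x \<otimes> y) \<le> nrm A x * nrm A y"
    and cstar_identity: "x \<in> carrier A \<Longrightarrow> nrm A (star A x \<otimes> x) = (nrm A x)\<^sup>2"
    and complete:
      "\<lbrakk>\<And>n. X n \<in> carrier A; nrm_Cauchy A X\<rbrakk> \<Longrightarrow> \<exists>x\<in>carrier A. nrm_tendsto A X x"

text \<open>Homomorphisms are unital, since \<open>ring_hom\<close> is.\<close>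

definition star_hom ::
  "('a, 'm) cstar_alg_scheme \<Rightarrow> ('b, 'k) cstar_alg_scheme \<Rightarrow> ('a \<Rightarrow> 'b) set" where
  "star_hom A B = {f \<in> ring_hom A B.
     (\<forall>c. \<forall>x\<in>carrier A. f (scal A c x) = scal B c (f x)) \<and>
     (\<forall>x\<in>carrier A. f (star A x) = star B (f x))}"

definition star_iso ::
  "('a, 'm) cstar_alg_scheme \<Rightarrow> ('b, 'k) cstar_alg_scheme \<Rightarrow> ('a \<Rightarrow> 'b) set" where
  "star_iso A B = {f \<in> star_hom A B. bij_betw f (carrier A) (carrier B)}"

definition cstar_subalgebra :: "('a, 'm) cstar_alg_scheme \<Rightarrow> 'a set \<Rightarrow> bool" where
  "cstar_subalgebra A B \<longleftrightarrow>
     B \<subseteq> carrier A \<and> \<one>\<^bsub>A\<^esub> \<in> B \<and>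
     (\<forall>x\<in>B. \<forall>y\<in>B. x \<oplus>\<^bsub>A\<^esub> y \<in> B \<and> x \<otimes>\<^bsub>A\<^esub> y \<in> B) \<and>
     (\<forall>c. \<forall>x\<in>B. scal A c x \<in> B) \<and>
     (\<forall>x\<in>B. star A x \<in> B) \<and>
     (\<forall>X x. (\<forall>n. X n \<in> B) \<and> x \<in> carrier A \<and> nrm_tendsto A X x \<longrightarrow> x \<in> B)"

definition cstar_generated :: "('a, 'm) cstar_alg_scheme \<Rightarrow> 'a set \<Rightarrow> 'a set" where
  "cstar_generated A X = \<Inter> {B. cstar_subalgebra A B \<and> X \<subseteq> B}"

definition C_interval :: "real \<Rightarrow> (real \<Rightarrow> complex) cstar_alg" where
  "C_interval b = \<lparr>
     carrier = {f. continuous_on {0..b} f \<and> f \<in> extensional {0..b}},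
     mult = (\<lambda>f g. \<lambda>x\<in>{0..b}. f x * g x),
     one = (\<lambda>x\<in>{0..b}. 1),
     zero = (\<lambda>x\<in>{0..b}. 0),
     add = (\<lambda>f g. \<lambda>x\<in>{0..b}. f x + g x),
     scal = (\<lambda>c f. \<lambda>x\<in>{0..b}. c * f x),
     star = (\<lambda>f. \<lambda>x\<in>{0..b}. cnj (f x)),
     nrm = (\<lambda>f. SUP x\<in>{0..b}. cmod (f x))\<rparr>"

subsection \<open>Universal C*-algebras\<close>

text \<open>
  \<open>R\<close> is a set of relations on an \<open>N \<times> N\<close> array of elements of a C*-algebra.
  The test algebras \<open>B\<close> range over all C*-algebras carried by subsets of the type of \<open>A\<close>. This is
  no restriction: the subalgebra generated by the \<open>V i j\<close> is separable, hence of the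
  cardinality of the continuum, and so has a copy inside the type of \<open>A\<close>.
\<close>

definition universal_cstar ::
  "nat \<Rightarrow> ('a cstar_alg \<Rightarrow> (nat \<Rightarrow> nat \<Rightarrow> 'a) \<Rightarrow> bool) \<Rightarrow> 'a cstar_alg \<Rightarrow> (nat \<Rightarrow> nat \<Rightarrow> 'a) \<Rightarrow> bool"
where
  "universal_cstar N R A U \<longleftrightarrow>
     unital_cstar_algebra A \<and> (\<forall>i<N. \<forall>j<N. U i j \<in> carrier A) \<and> R A U \<and>
     cstar_generated A {U i j |i j. i < N \<and> j < N} = carrier A \<and>
     (\<forall>B V. unital_cstar_algebra B \<and> (\<forall>i<N. \<forall>j<N. V i j \<in> carrier B) \<and> R B V \<longrightarrow>
        (\<exists>f\<in>star_hom A B. \<forall>i<N. \<forall>j<N. f (U i j) = V i j))"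

subsection \<open>The minimal tensor product\<close>

definition lin_indep :: "('a, 'm) cstar_alg_scheme \<Rightarrow> nat \<Rightarrow> (nat \<Rightarrow> 'a) \<Rightarrow> bool" where
  "lin_indep A n b \<longleftrightarrow>
     (\<forall>c. (\<Oplus>\<^bsub>A\<^esub>i\<in>{..<n}. scal A (c i) (b i)) = \<zero>\<^bsub>A\<^esub> \<longrightarrow> (\<forall>i<n. c i = 0))"

text \<open>
  \<open>T\<close>, with \<open>t x y\<close> in the role of the elementary tensor of \<open>x\<close> and \<open>y\<close>, is the completion of the
  algebraic tensor product of \<open>A\<close> and \<open>B\<close> with respect to some C*-norm. The clause with
  \<open>lin_indep\<close> says that the algebraic tensor product embeds.
\<close>

definition cstar_tensor ::
  "'a cstar_alg \<Rightarrow> 'b cstar_alg \<Rightarrow> 'c cstar_alg \<Rightarrow> ('a \<Rightarrow> 'b \<Rightarrow> 'c) \<Rightarrow> bool" where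
  "cstar_tensor A B T t \<longleftrightarrow>
     unital_cstar_algebra T \<and>
     (\<forall>x\<in>carrier A. \<forall>y\<in>carrier B. t x y \<in> carrier T) \<and>
     (\<forall>x\<in>carrier A. \<forall>x'\<in>carrier A. \<forall>y\<in>carrier B. t (x \<oplus>\<^bsub>A\<^esub> x') y = t x y \<oplus>\<^bsub>T\<^esub> t x' y) \<and>
     (\<forall>x\<in>carrier A. \<forall>y\<in>carrier B. \<forall>y'\<in>carrier B. t x (y \<oplus>\<^bsub>B\<^esub> y') = t x y \<oplus>\<^bsub>T\<^esub> t x y') \<and>
     (\<forall>c. \<forall>x\<in>carrier A. \<forall>y\<in>carrier B.
        t (scal A c x) y = scal T c (t x y) \<and> t x (scal B c y) = scal T c (t x y)) \<and>
     t \<one>\<^bsub>A\<^esub> \<one>\<^bsub>B\<^esub> = \<one>\<^bsub>T\<^esub> \<and>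
     (\<forall>x\<in>carrier A. \<forall>x'\<in>carrier A. \<forall>y\<in>carrier B. \<forall>y'\<in>carrier B.
        t x y \<otimes>\<^bsub>T\<^esub> t x' y' = t (x \<otimes>\<^bsub>A\<^esub> x') (y \<otimes>\<^bsub>B\<^esub> y')) \<and>
     (\<forall>x\<in>carrier A. \<forall>y\<in>carrier B. star T (t x y) = t (star A x) (star B y)) \<and>
     (\<forall>(n :: nat) a b. (\<forall>i<n. a i \<in> carrier A \<and> b i \<in> carrier B) \<and> lin_indep B n b \<and>
        (\<Oplus>\<^bsub>T\<^esub>i\<in>{..<n}. t (a i) (b i)) = \<zero>\<^bsub>T\<^esub> \<longrightarrow> (\<forall>i<n. a i = \<zero>\<^bsub>A\<^esub>)) \<and>
     cstar_generated T {t x y |x y. x \<in> carrier A \<and> y \<in> carrier B} = carrier T"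

text \<open>
  The minimal (spatial) norm is the least C*-norm on the algebraic tensor product. The competing
  completions \<open>T'\<close> are carried by subsets of the type of \<open>T\<close>, which is no restriction for
  separable \<open>A\<close> and \<open>B\<close>, by the same count of cardinalities as above.
\<close>

definition min_cstar_tensor ::
  "'a cstar_alg \<Rightarrow> 'b cstar_alg \<Rightarrow> 'c cstar_alg \<Rightarrow> ('a \<Rightarrow> 'b \<Rightarrow> 'c) \<Rightarrow> bool" where
  "min_cstar_tensor A B T t \<longleftrightarrow>
     cstar_tensor A B T t \<and>
     (\<forall>(T' :: 'c cstar_alg) t'. cstar_tensor A B T' t' \<longrightarrow>
        (\<forall>(n :: nat) a b. (\<forall>i<n. a i \<in> carrier A \<and> b i \<in> carrier B) \<longrightarrow>
           nrm T (\<Oplus>\<^bsub>T\<^esub>i\<in>{..<n}. t (a i) (b i)) \<le> nrm T' (\<Oplus>\<^bsub>T'\<^esub>i\<in>{..<n}. t' (a i) (b i))))"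

section \<open>Quantum groups and their corepresentations\<close>

record ('a, 'b) quantum_group =
  alg :: "'a cstar_alg"
  alg2 :: "'b cstar_alg"
  tens :: "'a \<Rightarrow> 'a \<Rightarrow> 'b"
  comult :: "'a \<Rightarrow> 'b"

text \<open>
  Only the data needed for corepresentations. For the quantum groups below, coassociativity and
  the density conditions follow from the value of the coproduct on the generators.
\<close>

definition has_coproduct :: "('a, 'b) quantum_group \<Rightarrow> bool" where
  "has_coproduct G \<longleftrightarrow>
     unital_cstar_algebra (alg G) \<and>
     min_cstar_tensor (alg G) (alg G) (alg2 G) (tens G) \<and>
     comult G \<in> star_hom (alg G) (alg2 G)"

text \<open>
  \<open>(n, u)\<close> stands for the \<open>n \<times> n\<close> matrix with entries \<open>u i j\<close> for \<open>i, j < n\<close>;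
  other values of \<open>u\<close> are irrelevant.
\<close>

type_synonym 'a amat = "nat \<times> (nat \<Rightarrow> nat \<Rightarrow> 'a)"

definition kron :: "('a, 'm) cstar_alg_scheme \<Rightarrow> nat \<Rightarrow> nat \<Rightarrow> 'a" where
  "kron A i j = (if i = j then \<one>\<^bsub>A\<^esub> else \<zero>\<^bsub>A\<^esub>)"

definition amat_invertible :: "'a cstar_alg \<Rightarrow> 'a amat \<Rightarrow> bool" where
  "amat_invertible A = (\<lambda>(n, u). \<exists>w. (\<forall>i<n. \<forall>j<n. w i j \<in> carrier A \<and>
      (\<Oplus>\<^bsub>A\<^esub>k\<in>{..<n}. u i k \<otimes>\<^bsub>A\<^esub> w k j) = kron A i j \<and>
      (\<Oplus>\<^bsub>A\<^esub>k\<in>{..<n}. w i k \<otimes>\<^bsub>A\<^esub> u k j) = kron A i j))"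

definition amat_unitary :: "'a cstar_alg \<Rightarrow> 'a amat \<Rightarrow> bool" where
  "amat_unitary A = (\<lambda>(n, u). \<forall>i<n. \<forall>j<n.
      (\<Oplus>\<^bsub>A\<^esub>k\<in>{..<n}. u i k \<otimes>\<^bsub>A\<^esub> star A (u j k)) = kron A i j \<and>
      (\<Oplus>\<^bsub>A\<^esub>k\<in>{..<n}. star A (u k i) \<otimes>\<^bsub>A\<^esub> u k j) = kron A i j)"

definition corep :: "('a, 'b) quantum_group \<Rightarrow> 'a amat \<Rightarrow> bool" where
  "corep G = (\<lambda>(n, u).
     (\<forall>i<n. \<forall>j<n. u i j \<in> carrier (alg G) \<and>
        comult G (u i j) = (\<Oplus>\<^bsub>alg2 G\<^esub>k\<in>{..<n}. tens G (u i k) (u k j))) \<and>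
     amat_invertible (alg G) (n, u))"

definition intertwiners :: "'a cstar_alg \<Rightarrow> 'a amat \<Rightarrow> 'a amat \<Rightarrow> complex mat set" where
  "intertwiners A = (\<lambda>(n, u) (m, w). {T \<in> carrier_mat m n. \<forall>i<m. \<forall>j<n.
      (\<Oplus>\<^bsub>A\<^esub>k\<in>{..<n}. scal A (T $$ (i, k)) (u k j)) =
      (\<Oplus>\<^bsub>A\<^esub>k\<in>{..<m}. scal A (T $$ (k, j)) (w i k))})"

definition corep_equiv :: "('a, 'b) quantum_group \<Rightarrow> 'a amat \<Rightarrow> 'a amat \<Rightarrow> bool" where
  "corep_equiv G u w \<longleftrightarrow>
     corep G u \<and> corep G w \<and> (\<exists>T\<in>intertwiners (alg G) u w. invertible_mat T)"

definition irreducible_corep :: "('a, 'b) quantum_group \<Rightarrow> 'a amat \<Rightarrow> bool" where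
  "irreducible_corep G u \<longleftrightarrow>
     corep G u \<and> fst u > 0 \<and>
     (\<forall>T\<in>intertwiners (alg G) u u. \<exists>c. T = c \<cdot>\<^sub>m 1\<^sub>m (fst u))"

definition trivial_corep :: "'a cstar_alg \<Rightarrow> 'a amat" where
  "trivial_corep A = (1, \<lambda>i j. \<one>\<^bsub>A\<^esub>)"

definition corep_sum :: "'a cstar_alg \<Rightarrow> 'a amat \<Rightarrow> 'a amat \<Rightarrow> 'a amat" where
  "corep_sum A = (\<lambda>(n, u) (m, w). (n + m, \<lambda>i j.
      if i < n \<and> j < n then u i j
      else if n \<le> i \<and> n \<le> j then w (i - n) (j - n)
      else \<zero>\<^bsub>A\<^esub>))"

definition corep_sum_list :: "'a cstar_alg \<Rightarrow> 'a amat list \<Rightarrow> 'a amat" where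
  "corep_sum_list A us = foldr (corep_sum A) us (0, \<lambda>i j. \<zero>\<^bsub>A\<^esub>)"

text \<open>The pair of indices \<open>(i, k)\<close>, with \<open>k < m\<close>, is encoded as \<open>i * m + k\<close>.\<close>

definition corep_tensor :: "'a cstar_alg \<Rightarrow> 'a amat \<Rightarrow> 'a amat \<Rightarrow> 'a amat" where
  "corep_tensor A = (\<lambda>(n, u) (m, w). (n * m, \<lambda>i j.
      u (i div m) (j div m) \<otimes>\<^bsub>A\<^esub> w (i mod m) (j mod m)))"

definition corep_conj :: "'a cstar_alg \<Rightarrow> 'a amat \<Rightarrow> 'a amat" where
  "corep_conj A = (\<lambda>(n, u). (n, \<lambda>i j. star A (u i j)))"

definition corep_char :: "'a cstar_alg \<Rightarrow> 'a amat \<Rightarrow> 'a" where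
  "corep_char A = (\<lambda>(n, u). (\<Oplus>\<^bsub>A\<^esub>i\<in>{..<n}. u i i))"

definition central_alg :: "('a, 'b) quantum_group \<Rightarrow> 'a set" where
  "central_alg G = cstar_generated (alg G) {corep_char (alg G) u |u. irreducible_corep G u}"

section \<open>Quantum reflection groups and quantum permutation groups\<close>

definition reflection_relations ::
  "nat \<Rightarrow> nat \<Rightarrow> 'a cstar_alg \<Rightarrow> (nat \<Rightarrow> nat \<Rightarrow> 'a) \<Rightarrow> bool" where
  "reflection_relations N s A U \<longleftrightarrow>
     amat_unitary A (N, U) \<and> amat_unitary A (N, \<lambda>i j. U j i) \<and>
     (\<forall>i<N. \<forall>j<N.
        U i j \<otimes>\<^bsub>A\<^esub> star A (U i j) = star A (U i j) \<otimes>\<^bsub>A\<^esub> U i j \<and>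
        (let p = U i j \<otimes>\<^bsub>A\<^esub> star A (U i j)
         in star A p = p \<and> p \<otimes>\<^bsub>A\<^esub> p = p \<and> U i j [^]\<^bsub>A\<^esub> s = p))"

definition permutation_relations ::
  "nat \<Rightarrow> 'a cstar_alg \<Rightarrow> (nat \<Rightarrow> nat \<Rightarrow> 'a) \<Rightarrow> bool" where
  "permutation_relations N A v \<longleftrightarrow>
     amat_unitary A (N, v) \<and> amat_unitary A (N, \<lambda>i j. v j i) \<and>
     (\<forall>i<N. \<forall>j<N. v i j = star A (v i j) \<and> v i j = v i j \<otimes>\<^bsub>A\<^esub> v i j)"

definition coproduct_on_generators ::
  "nat \<Rightarrow> ('a, 'b) quantum_group \<Rightarrow> (nat \<Rightarrow> nat \<Rightarrow> 'a) \<Rightarrow> bool" where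
  "coproduct_on_generators N G U \<longleftrightarrow>
     (\<forall>i<N. \<forall>j<N. comult G (U i j) = (\<Oplus>\<^bsub>alg2 G\<^esub>k\<in>{..<N}. tens G (U i k) (U k j)))"

definition quantum_reflection_group ::
  "nat \<Rightarrow> nat \<Rightarrow> ('a, 'b) quantum_group \<Rightarrow> (nat \<Rightarrow> nat \<Rightarrow> 'a) \<Rightarrow> bool" where
  "quantum_reflection_group N s G U \<longleftrightarrow>
     universal_cstar N (reflection_relations N s) (alg G) U \<and>
     has_coproduct G \<and> coproduct_on_generators N G U"

definition quantum_permutation_group ::
  "nat \<Rightarrow> ('a, 'b) quantum_group \<Rightarrow> (nat \<Rightarrow> nat \<Rightarrow> 'a) \<Rightarrow> bool" where
  "quantum_permutation_group N G v \<longleftrightarrow>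
     universal_cstar N (permutation_relations N) (alg G) v \<and>
     has_coproduct G \<and> coproduct_on_generators N G v"

text \<open>The membership clause says that \<open>\<chi>\<close> lies in the domain of \<open>\<Phi>\<close>.\<close>

definition central_identification ::
  "nat \<Rightarrow> ('a, 'b) quantum_group \<Rightarrow> (nat \<Rightarrow> nat \<Rightarrow> 'a) \<Rightarrow> ('a \<Rightarrow> real \<Rightarrow> complex) \<Rightarrow> bool" where
  "central_identification N G v \<Phi> \<longleftrightarrow>
     \<Phi> \<in> star_iso ((alg G)\<lparr>carrier := central_alg G\<rparr>) (C_interval (real N)) \<and>
     corep_char (alg G) (N, v) \<in> central_alg G \<and>
     \<Phi> (corep_char (alg G) (N, v)) = (\<lambda>x\<in>{0..real N}. complex_of_real x)"

section \<open>The monoid \<open>\<langle>a, z : z\<^sup>s = 1\<rangle>\<close>, its submonoid \<open>S\<close> and the fusion rules\<close>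

datatype letter = La | Lz

definition word_step :: "nat \<Rightarrow> (letter list \<times> letter list) set" where
  "word_step s = {(x @ replicate s Lz @ y, x @ y) |x y. True}"

definition word_cong :: "nat \<Rightarrow> (letter list \<times> letter list) set" where
  "word_cong s = (word_step s \<union> (word_step s)\<inverse>)\<^sup>*"

definition word_class :: "nat \<Rightarrow> letter list \<Rightarrow> letter list set" where
  "word_class s w = word_cong s `` {w}"

definition M_monoid :: "nat \<Rightarrow> letter list set monoid" where
  "M_monoid s = \<lparr>
     carrier = UNIV // word_cong s,
     mult = (\<lambda>X Y. \<Union>x\<in>X. \<Union>y\<in>Y. word_class s (x @ y)),
     one = word_class s []\<rparr>"

abbreviation gen_a :: "nat \<Rightarrow> letter list set" where
  "gen_a s \<equiv> word_class s [La]"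

abbreviation gen_z :: "nat \<Rightarrow> letter list set" where
  "gen_z s \<equiv> word_class s [Lz]"

text \<open>The antimultiplicative involution with \<open>a \<mapsto> a\<close> and \<open>z \<mapsto> z\<^sup>-\<^sup>1\<close>, which is \<open>z\<close> to the \<open>s - 1\<close>.\<close>

definition word_inv :: "nat \<Rightarrow> letter list \<Rightarrow> letter list" where
  "word_inv s w =
     concat (map (\<lambda>c. case c of La \<Rightarrow> [La] | Lz \<Rightarrow> replicate (s - 1) Lz) (rev w))"

definition M_inv :: "nat \<Rightarrow> letter list set \<Rightarrow> letter list set" where
  "M_inv s X = (\<Union>x\<in>X. word_class s (word_inv s x))"

definition aza :: "nat \<Rightarrow> nat \<Rightarrow> letter list set" where
  "aza s i = gen_a s \<otimes>\<^bsub>M_monoid s\<^esub> gen_z s [^]\<^bsub>M_monoid s\<^esub> i \<otimes>\<^bsub>M_monoid s\<^esub> gen_a s"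

inductive_set S_monoid :: "nat \<Rightarrow> letter list set set" for s where
  one: "\<one>\<^bsub>M_monoid s\<^esub> \<in> S_monoid s"
| mult: "\<lbrakk>x \<in> S_monoid s; i < s\<rbrakk> \<Longrightarrow> x \<otimes>\<^bsub>M_monoid s\<^esub> aza s i \<in> S_monoid s"

text \<open>
  \<open>fusion s x y \<gamma>s\<close>: the recursion evaluates \<open>x \<otimes> y\<close> to the direct sum of the elements of \<open>\<gamma>s\<close>,
  listed with multiplicity. On pairs of elements of \<open>S\<close> it never meets a factor that is a
  nontrivial power of \<open>z\<close>, for which there is no rule.
\<close>

inductive fusion ::
  "nat \<Rightarrow> letter list set \<Rightarrow> letter list set \<Rightarrow> letter list set list \<Rightarrow> bool" for s where
  unit_left: "y \<in> carrier (M_monoid s) \<Longrightarrow> fusion s \<one>\<^bsub>M_monoid s\<^esub> y [y]"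
| unit_right: "x \<in> carrier (M_monoid s) \<Longrightarrow> fusion s x \<one>\<^bsub>M_monoid s\<^esub> [x]"
| nonzero: "\<lbrakk>v \<in> carrier (M_monoid s); w \<in> carrier (M_monoid s); \<not> s dvd i + j\<rbrakk> \<Longrightarrow>
    fusion s
      (v \<otimes>\<^bsub>M_monoid s\<^esub> gen_a s \<otimes>\<^bsub>M_monoid s\<^esub> gen_z s [^]\<^bsub>M_monoid s\<^esub> i)
      (gen_z s [^]\<^bsub>M_monoid s\<^esub> j \<otimes>\<^bsub>M_monoid s\<^esub> gen_a s \<otimes>\<^bsub>M_monoid s\<^esub> w)
      [v \<otimes>\<^bsub>M_monoid s\<^esub> aza s (i + j) \<otimes>\<^bsub>M_monoid s\<^esub> w]"
| zero: "\<lbrakk>v \<in> carrier (M_monoid s); w \<in> carrier (M_monoid s); s dvd i + j; fusion s v w \<gamma>s\<rbrakk> \<Longrightarrow>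
    fusion s
      (v \<otimes>\<^bsub>M_monoid s\<^esub> gen_a s \<otimes>\<^bsub>M_monoid s\<^esub> gen_z s [^]\<^bsub>M_monoid s\<^esub> i)
      (gen_z s [^]\<^bsub>M_monoid s\<^esub> j \<otimes>\<^bsub>M_monoid s\<^esub> gen_a s \<otimes>\<^bsub>M_monoid s\<^esub> w)
      ((v \<otimes>\<^bsub>M_monoid s\<^esub> aza s (i + j) \<otimes>\<^bsub>M_monoid s\<^esub> w) # \<gamma>s)"

text \<open>\<open>alt_word s [l\<^sub>1, \<dots>, l\<^sub>k] [j\<^sub>1, \<dots>, j\<^sub>k\<^sub>-\<^sub>1]\<close> is the product of
  \<open>a\<close> to the \<open>l\<^sub>1\<close>, \<open>z\<close> to the \<open>j\<^sub>1\<close>, \<dots>, \<open>a\<close> to the \<open>l\<^sub>k\<close>.\<close>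

fun alt_word :: "nat \<Rightarrow> nat list \<Rightarrow> nat list \<Rightarrow> letter list set" where
  "alt_word s [] js = \<one>\<^bsub>M_monoid s\<^esub>"
| "alt_word s (l # ls) [] = gen_a s [^]\<^bsub>M_monoid s\<^esub> l \<otimes>\<^bsub>M_monoid s\<^esub> alt_word s ls []"
| "alt_word s (l # ls) (j # js) =
     gen_a s [^]\<^bsub>M_monoid s\<^esub> l \<otimes>\<^bsub>M_monoid s\<^esub> gen_z s [^]\<^bsub>M_monoid s\<^esub> j
       \<otimes>\<^bsub>M_monoid s\<^esub> alt_word s ls js"

definition normal_form :: "nat \<Rightarrow> letter list set \<Rightarrow> nat list \<Rightarrow> nat list \<Rightarrow> bool" where
  "normal_form s \<alpha> ls js \<longleftrightarrow>
     \<alpha> = alt_word s ls js \<and> length js = length ls - 1 \<and>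
     (\<forall>l\<in>set ls. 0 < l) \<and> (\<forall>j\<in>set js. 1 \<le> j \<and> j \<le> s - 1) \<and>
     (length ls = 1 \<longrightarrow> even (ls ! 0)) \<and>
     (length ls \<ge> 2 \<longrightarrow>
        odd (ls ! 0) \<and> odd (ls ! (length ls - 1)) \<and>
        (\<forall>i. 1 \<le> i \<and> i < length ls - 1 \<longrightarrow> even (ls ! i)))"

section \<open>The irreducible corepresentations of \<open>C(H\<^sub>N\<^sup>s\<^sup>+)\<close>\<close>

text \<open>\<open>U\<^sub>t\<close>, where \<open>U\<^sub>0\<close> is \<open>(U\<^sub>i\<^sub>j U\<^sub>i\<^sub>j\<^sup>*)\<close> and not the entrywise zeroth power.\<close>

definition U_corep :: "nat \<Rightarrow> 'a cstar_alg \<Rightarrow> (nat \<Rightarrow> nat \<Rightarrow> 'a) \<Rightarrow> nat \<Rightarrow> 'a amat" where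
  "U_corep N A U t = (N, \<lambda>i j.
     if t = 0 then U i j \<otimes>\<^bsub>A\<^esub> star A (U i j) else U i j [^]\<^bsub>A\<^esub> t)"

text \<open>
  The labelling of the irreducible corepresentations by \<open>S\<close> found by Banica and Vergnioux.
  The corepresentation \<open>U\<^sub>0 \<ominus> 1\<close> is characterised, up to equivalence, by its direct sum with
  the trivial one being equivalent to \<open>U\<^sub>0\<close>.
\<close>

definition irrep_labelling ::
  "nat \<Rightarrow> nat \<Rightarrow> ('a, 'b) quantum_group \<Rightarrow> (nat \<Rightarrow> nat \<Rightarrow> 'a) \<Rightarrow> (letter list set \<Rightarrow> 'a amat) \<Rightarrow> bool"
where
  "irrep_labelling N s G U r \<longleftrightarrow>
     (\<forall>\<alpha>\<in>S_monoid s. irreducible_corep G (r \<alpha>)) \<and>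
     (\<forall>u. irreducible_corep G u \<longrightarrow> (\<exists>!\<alpha>. \<alpha> \<in> S_monoid s \<and> corep_equiv G u (r \<alpha>))) \<and>
     corep_equiv G (r \<one>\<^bsub>M_monoid s\<^esub>) (trivial_corep (alg G)) \<and>
     corep_equiv G (corep_sum (alg G) (r (aza s 0)) (trivial_corep (alg G)))
       (U_corep N (alg G) U 0) \<and>
     (\<forall>t. 1 \<le> t \<and> t \<le> s - 1 \<longrightarrow> corep_equiv G (r (aza s t)) (U_corep N (alg G) U t)) \<and>
     (\<forall>\<alpha>\<in>S_monoid s. corep_equiv G (corep_conj (alg G) (r \<alpha>)) (r (M_inv s \<alpha>))) \<and>
     (\<forall>\<alpha>\<in>S_monoid s. \<forall>\<beta>\<in>S_monoid s. \<forall>\<gamma>s. fusion s \<alpha> \<beta> \<gamma>s \<longrightarrow>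
        corep_equiv G (corep_tensor (alg G) (r \<alpha>) (r \<beta>)) (corep_sum_list (alg G) (map r \<gamma>s)))"

end

theory Submission
  imports Defs "HOL-Algebra.UnivPoly"
begin

text \<open>
  \<^emph>\<open>Why the formula holds.\<close> An element of \<open>S\<close> is spelled by a list of exponents:
  \<open>[i\<^sub>1, \<dots>, i\<^sub>n]\<close> stands for \<open>az\<^bsup>i\<^sub>1\<^esup>a \<cdots> az\<^bsup>i\<^sub>n\<^esup>a\<close> (\<open>S_word\<close>). Two adjacent letters
  \<open>a\<close> meet where the factors \<open>(\<dots>i)\<close> and \<open>j\<close> touch, so the fusion rules apply twice and give
  \<open>xs i \<otimes> j = xs i j \<oplus> xs (i + j) (\<oplus> xs if i + j = 0)\<close>, sums being taken modulo \<open>s\<close>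
  (\<open>fusion_S_word_snoc\<close>). Characters turn equivalence, direct sum and tensor product into equality,
  sum and product (\<open>corep_char_equiv\<close>, \<open>corep_char_sum\<close>, \<open>corep_char_tensor\<close>), so the same
  identity holds between the characters. On its right-hand side the list \<open>xs i j\<close> is longer than
  all other lists in the identity, so solving for its character computes all characters from those
  of the lists of length at most one.

  Under \<open>\<pi>\<close>, the characters of all \<open>U\<^sub>t\<close> become \<open>\<chi> = \<Sum>\<^sub>i v\<^sub>i\<^sub>i\<close>, because the \<open>v\<^sub>i\<^sub>i\<close> are projections
  (\<open>image_char_U_corep\<close>). The list \<open>[t]\<close> therefore has image \<open>\<chi>\<close> if \<open>t \<noteq> 0\<close>, and \<open>\<chi> - 1\<close> if
  \<open>t = 0\<close>. At \<open>\<chi> = X\<^sup>2\<close> these are \<open>A\<^sub>1A\<^sub>1\<close> and \<open>A\<^sub>2\<close>, as they should be.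

  It remains to see that the products of the \<open>A\<^sub>l\<close> satisfy the same recursion
  (\<open>run_poly_recursion\<close>). Appending \<open>0\<close>, that is \<open>aa\<close>, lengthens the last run of letters \<open>a\<close> by
  two; appending \<open>i \<noteq> 0\<close> lengthens it by one and opens a new run of length one. So only the
  runs at the end change, and there the claim follows from the recursion of the \<open>A\<^sub>t\<close>.
  By the parity conditions in the normal form, \<open>\<alpha>\<close> is spelled by a list of exponents whose
  polynomial is the product in the claim (\<open>normal_form_S_word\<close>).
\<close>

section \<open>The monoid and its fusion rules\<close>

lemma equiv_word_cong: "equiv UNIV (word_cong s)"
  unfolding word_cong_def
  by (intro equivI refl_rtrancl sym_rtrancl sym_Un_converse trans_rtrancl) simp

lemma word_step_context:
  assumes "(x, y) \<in> word_step s"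
  shows "(u @ x @ w, u @ y @ w) \<in> word_step s"
proof -
  obtain a b where "x = a @ replicate s Lz @ b" "y = a @ b"
    using assms by (auto simp: word_step_def)
  then have "u @ x @ w = (u @ a) @ replicate s Lz @ (b @ w)" "u @ y @ w = (u @ a) @ (b @ w)"
    by simp_all
  then show ?thesis unfolding word_step_def by blast
qed

lemma word_cong_context:
  assumes "(x, y) \<in> word_cong s"
  shows "(u @ x @ w, u @ y @ w) \<in> word_cong s"
  using assms unfolding word_cong_def
proof (induction rule: rtrancl_induct)
  case base
  then show ?case by simp
next
  case (step y z)
  then have "(u @ y @ w, u @ z @ w) \<in> word_step s \<union> (word_step s)\<inverse>"
    using word_step_context by auto
  with step.IH show ?case by (rule rtrancl_into_rtrancl)
qed

lemma word_class_eq_iff: "word_class s x = word_class s y \<longleftrightarrow> (x, y) \<in> word_cong s"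
  unfolding word_class_def by (rule eq_equiv_class_iff[OF equiv_word_cong]) auto

lemma mem_word_class_iff: "x \<in> word_class s y \<longleftrightarrow> (y, x) \<in> word_cong s"
  by (simp add: word_class_def)

lemma word_class_mult:
  "word_class s x \<otimes>\<^bsub>M_monoid s\<^esub> word_class s y = word_class s (x @ y)"
proof -
  have *: "word_class s (x' @ y') = word_class s (x @ y)"
    if "x' \<in> word_class s x" "y' \<in> word_class s y" for x' y'
  proof -
    have "word_class s (x @ y) = word_class s (x' @ y)"
      using that(1) word_cong_context[of x x' s "[]" y]
      by (simp add: mem_word_class_iff word_class_eq_iff)
    also have "\<dots> = word_class s (x' @ y')"
      using that(2) word_cong_context[of y y' s x' "[]"]
      by (simp add: mem_word_class_iff word_class_eq_iff)
    finally show ?thesis by simp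
  qed
  have mem: "x \<in> word_class s x" "y \<in> word_class s y"
    by (simp_all add: mem_word_class_iff word_cong_def)
  have "(\<Union>x'\<in>word_class s x. \<Union>y'\<in>word_class s y. word_class s (x' @ y')) = word_class s (x @ y)"
  proof (intro equalityI UN_least)
    show "word_class s (x' @ y') \<subseteq> word_class s (x @ y)"
      if "x' \<in> word_class s x" "y' \<in> word_class s y" for x' y'
      using *[OF that] by simp
  qed (use mem in blast)
  then show ?thesis by (simp add: M_monoid_def)
qed

lemma one_M_monoid: "\<one>\<^bsub>M_monoid s\<^esub> = word_class s []"
  by (simp add: M_monoid_def)

lemma word_class_in_carrier: "word_class s x \<in> carrier (M_monoid s)"
  by (simp add: M_monoid_def word_class_def quotientI)

lemma word_class_pow:
  "word_class s [c] [^]\<^bsub>M_monoid s\<^esub> (n :: nat) = word_class s (replicate n c)"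
  by (induction n) (simp_all add: one_M_monoid word_class_mult replicate_append_same)

lemmas word_class_simps = word_class_mult one_M_monoid word_class_pow

text \<open>
  The relation \<open>z\<^sup>s = 1\<close> in context. It lets the exponent \<open>i + j\<close> produced by the fusion rules be
  replaced by one below \<open>s\<close>, as the labels in \<open>S\<close> require.
\<close>

lemma word_class_replicate_mod:
  "word_class s (u @ replicate (i mod s) Lz @ w) = word_class s (u @ replicate i Lz @ w)"
proof (induction i rule: less_induct)
  case (less i)
  show ?case
  proof (cases "s = 0 \<or> i < s")
    case True
    then show ?thesis by auto
  next
    case False
    then have "replicate i Lz = replicate s Lz @ replicate (i - s) Lz"
      by (simp flip: replicate_add)
    then have "(u @ replicate i Lz @ w, u @ replicate (i - s) Lz @ w) \<in> word_step s"
      unfolding word_step_def by auto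
    then have "word_class s (u @ replicate i Lz @ w) = word_class s (u @ replicate (i - s) Lz @ w)"
      unfolding word_class_eq_iff word_cong_def by blast
    moreover have "i mod s = (i - s) mod s"
      using False by (simp add: le_mod_geq)
    ultimately show ?thesis using less.IH[of "i - s"] False by simp
  qed
qed

definition S_word :: "nat list \<Rightarrow> letter list" where
  "S_word xs = concat (map (\<lambda>i. La # replicate i Lz @ [La]) xs)"

lemma S_word_Nil [simp]: "S_word [] = []"
  and S_word_Cons [simp]: "S_word (i # xs) = La # replicate i Lz @ La # S_word xs"
  and S_word_append [simp]: "S_word (xs @ ys) = S_word xs @ S_word ys"
  by (simp_all add: S_word_def)

lemma S_word_replicate_0: "S_word (replicate m 0) = replicate (2 * m) La"
  by (induction m) auto

lemma aza_eq: "aza s i = word_class s (S_word [i])"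
  by (simp add: aza_def word_class_simps)

lemma S_word_in_S_monoid:
  assumes "set xs \<subseteq> {..<s}"
  shows "word_class s (S_word xs) \<in> S_monoid s"
  using assms
proof (induction xs rule: rev_induct)
  case Nil
  then show ?case using S_monoid.one[of s] by (simp add: one_M_monoid)
next
  case (snoc i xs)
  then show ?case
    using S_monoid.mult[of "word_class s (S_word xs)" s i] by (simp add: aza_eq word_class_simps)
qed

text \<open>
  At the junction of \<open>\<dots>az\<^sup>ia\<close> and \<open>az\<^sup>ja\<close> no power of \<open>z\<close> separates the two letters \<open>a\<close>, so the
  cancelling rule applies with exponents \<open>0\<close> and \<open>0\<close>. It yields the concatenation and leaves
  \<open>\<dots>az\<^sup>i \<otimes> z\<^sup>ja\<close>, whose evaluation depends on whether \<open>s\<close> divides \<open>i + j\<close>; if it does,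
  both letters \<open>a\<close> cancel and \<open>xs\<close> is tensored with the unit.
\<close>

lemma fusion_S_word_snoc:
  "fusion s (word_class s (S_word (xs @ [i]))) (word_class s (S_word [j]))
     (word_class s (S_word (xs @ [i, j])) # word_class s (S_word (xs @ [(i + j) mod s])) #
       (if s dvd i + j then [word_class s (S_word xs)] else []))"
proof -
  let ?c = "word_class s"
  let ?tail = "if s dvd i + j then [?c (S_word xs)] else []"
  have mod: "?c (S_word xs @ La # replicate (i + j) Lz @ [La])
      = ?c (S_word (xs @ [(i + j) mod s]))"
    using word_class_replicate_mod[of s "S_word xs @ [La]" "i + j" "[La]"] by simp
  have "fusion s (?c (S_word xs @ La # replicate i Lz)) (?c (replicate j Lz @ [La]))
      (?c (S_word (xs @ [(i + j) mod s])) # ?tail)"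
  proof (cases "s dvd i + j")
    case True
    have "fusion s (?c (S_word xs)) (?c []) [?c (S_word xs)]"
      using fusion.unit_right[OF word_class_in_carrier, of s "S_word xs"]
      by (simp add: one_M_monoid)
    from fusion.zero[OF word_class_in_carrier word_class_in_carrier True this]
    show ?thesis using True mod by (simp add: word_class_simps aza_eq)
  next
    case False
    from fusion.nonzero[OF word_class_in_carrier word_class_in_carrier False,
        of "S_word xs" "[]"]
    show ?thesis using False mod by (simp add: word_class_simps aza_eq)
  qed
  from fusion.zero[OF word_class_in_carrier word_class_in_carrier _ this, of 0 0]
  show ?thesis by (simp add: word_class_simps aza_eq)
qed

section \<open>The polynomials attached to words\<close>

text \<open>
  The state \<open>(q, l)\<close> after reading a list of exponents: \<open>l\<close> is the length of the last run of letters
  \<open>a\<close> in the word read so far and \<open>q\<close> the product of the \<open>A\<close> over the earlier runs. The empty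
  word has the state \<open>(1, 0)\<close>, in which \<open>A\<^sub>0 = 1\<close> makes the empty last run harmless.
\<close>

fun run_step :: "real poly \<times> nat \<Rightarrow> nat \<Rightarrow> real poly \<times> nat" where
  "run_step (q, l) i = (if i = 0 then (q, l + 2) else (q * A_poly (l + 1), 1))"

definition run_value :: "real poly \<times> nat \<Rightarrow> real poly" where
  "run_value = (\<lambda>(q, l). q * A_poly l)"

definition run_poly :: "nat list \<Rightarrow> real poly" where
  "run_poly xs = run_value (foldl run_step (1, 0) xs)"

lemma run_poly_Nil: "run_poly [] = 1"
  by (simp add: run_poly_def run_value_def)

lemma poly_run_poly_single:
  "poly (run_poly [j]) x = (if j = 0 then x\<^sup>2 - 1 else x\<^sup>2)"
  by (simp add: run_poly_def run_value_def numeral_2_eq_2 power2_eq_square)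

lemma poly_A_poly_Suc_Suc:
  "poly (A_poly (Suc (Suc t))) x = x * poly (A_poly (Suc t)) x - poly (A_poly t) x"
  by simp

text \<open>
  With \<open>(q, l)\<close> the state after \<open>xs\<close>, each of the five cases has the factor \<open>q\<close> in common, and
  what is left is a linear identity between \<open>A\<^sub>l\<close> and \<open>A\<^bsub>l+1\<^esub>\<close> over the polynomials in \<open>x\<close>, to which
  all higher \<open>A\<close> reduce. For instance \<open>i = j = 0\<close> is
  \<open>A\<^bsub>l+2\<^esub> (x\<^sup>2 - 1) = A\<^bsub>l+4\<^esub> + A\<^bsub>l+2\<^esub> + A\<^sub>l\<close>.
\<close>

lemma run_poly_recursion:
  assumes "i < s" "j < s"
  shows "poly (run_poly (xs @ [i])) x * poly (run_poly [j]) x =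
    poly (run_poly (xs @ [i, j])) x + poly (run_poly (xs @ [(i + j) mod s])) x
      + (if s dvd i + j then poly (run_poly xs) x else 0)"
proof -
  obtain q l where ql: "foldl run_step (1, 0) xs = (q, l)" by fastforce
  have single: "run_poly (xs @ [k]) = run_value (run_step (q, l) k)" for k
    by (simp add: run_poly_def ql)
  have double: "run_poly (xs @ [k, m]) = run_value (run_step (run_step (q, l) k) m)" for k m
    by (simp add: run_poly_def ql)
  have base: "run_poly xs = q * A_poly l"
    by (simp add: run_poly_def ql run_value_def)
  define a b where "a = poly (A_poly l) x" and "b = poly (A_poly (l + 1)) x"
  have A2: "poly (A_poly (l + 2)) x = x * b - a"
    by (simp add: a_def b_def)
  then have A3: "poly (A_poly (l + 3)) x = x * (x * b - a) - b"
    using poly_A_poly_Suc_Suc[of "l + 1" x] by (simp add: b_def numeral_3_eq_3)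
  then have A4: "poly (A_poly (l + 4)) x = x * (x * (x * b - a) - b) - (x * b - a)"
    using poly_A_poly_Suc_Suc[of "l + 2" x] A2 by (simp add: numeral_eq_Suc)
  have small: "poly (A_poly 1) x = x" "poly (A_poly (1 + 1)) x = x * x - 1"
    "poly (A_poly (1 + 2)) x = x * (x * x - 1) - x"
    by (simp_all add: numeral_2_eq_2 algebra_simps)
  note val = run_value_def run_step.simps prod.case poly_mult
  consider "i = 0" "j = 0" | "i = 0" "j \<noteq> 0" | "i \<noteq> 0" "j = 0"
    | "i \<noteq> 0" "j \<noteq> 0" "s dvd i + j" | "i \<noteq> 0" "j \<noteq> 0" "\<not> s dvd i + j"
    by blast
  then show ?thesis
  proof cases
    case 1
    then show ?thesis
      by (simp add: poly_run_poly_single single double base val A2 A4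
          del: A_poly.simps) (simp add: a_def b_def algebra_simps power2_eq_square)
  next
    case 2
    then have "(i + j) mod s \<noteq> 0" "\<not> s dvd i + j"
      using assms by (simp_all add: dvd_eq_mod_eq_0)
    with 2 show ?thesis
      by (simp add: poly_run_poly_single single double base val A2 A3 small
          del: A_poly.simps) (simp add: a_def b_def algebra_simps power2_eq_square)
  next
    case 3
    then have "(i + j) mod s \<noteq> 0" "\<not> s dvd i + j"
      using assms by (simp_all add: dvd_eq_mod_eq_0)
    with 3 show ?thesis
      by (simp add: poly_run_poly_single single double base val A2 A3 small
          del: A_poly.simps) (simp add: a_def b_def algebra_simps power2_eq_square)
  next
    case 4
    then have "(i + j) mod s = 0" by simp
    with 4 show ?thesis
      by (simp add: poly_run_poly_single single double base val A2 small
          del: A_poly.simps) (simp add: a_def b_def algebra_simps power2_eq_square)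
  next
    case 5
    then have "(i + j) mod s \<noteq> 0" by (simp add: dvd_eq_mod_eq_0)
    with 5 show ?thesis
      by (simp add: poly_run_poly_single single double base val A2 small
          del: A_poly.simps) (simp add: a_def b_def algebra_simps power2_eq_square)
  qed
qed

lemma foldl_run_step_replicate_0: "foldl run_step (q, l) (replicate m 0) = (q, l + 2 * m)"
  by (induction m arbitrary: l) auto

text \<open>
  Reading a normal form from left to right. Here \<open>c\<close> is the number of letters \<open>a\<close> of the current run
  that earlier exponents have already supplied: none at the start, and one after an exponent
  \<open>j \<noteq> 0\<close>, whose factor \<open>az\<^sup>ja\<close> ends in the first letter of the next run. The rest of a run is
  filled up by factors \<open>aa\<close>, except that a further \<open>az\<^sup>ja\<close> needs one letter for itself; hence
  the parities of \<open>l + c\<close>.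
\<close>

lemma normal_form_tail:
  assumes "length ls = length js" and "c \<le> l"
    and "js = [] \<Longrightarrow> even (l + c)" and "js \<noteq> [] \<Longrightarrow> odd (l + c)"
    and "js \<noteq> [] \<Longrightarrow> odd (last ls)"
    and "\<forall>i<length ls - 1. even (ls ! i)"
    and "\<forall>k\<in>set ls. 0 < k" and "\<forall>j\<in>set js. 1 \<le> j \<and> j \<le> s - 1" and "1 \<le> s"
  shows "\<exists>xs. set xs \<subseteq> {..<s} \<and>
    alt_word s (l # ls) js = word_class s (replicate c La @ S_word xs) \<and>
    run_value (foldl run_step (q, c) xs) = q * prod_list (map A_poly (l # ls))"
  using assms
proof (induction js arbitrary: c l ls q)
  case Nil
  then obtain m where m: "l = c + 2 * m"
    by (metis add.commute even_add even_diff_nat le_add_diff_inverse dvd_def)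
  show ?case
  proof (intro exI conjI)
    show "set (replicate m 0) \<subseteq> {..<s}" using Nil by auto
    show "alt_word s (l # ls) [] = word_class s (replicate c La @ S_word (replicate m 0))"
      using Nil by (simp add: word_class_simps S_word_replicate_0 m replicate_add)
    show "run_value (foldl run_step (q, c) (replicate m 0)) = q * prod_list (map A_poly (l # ls))"
      using Nil by (simp add: foldl_run_step_replicate_0 run_value_def m)
  qed
next
  case (Cons j js)
  have "c < l" "odd (l - c)" using Cons.prems(2,4) by (auto simp: order_le_less)
  then obtain m where m: "l = Suc (c + 2 * m)"
    by (metis add_Suc_right le_add_diff_inverse less_imp_le oddE Suc_eq_plus1)
  obtain l' ls' where ls: "ls = l' # ls'" using Cons.prems(1) by (cases ls) auto
  have len: "length ls' = length js" using Cons.prems(1) ls by simp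
  have j: "0 < j" "j < s" using Cons.prems(8,9) by auto
  have e: "\<exists>xs. set xs \<subseteq> {..<s} \<and>
    alt_word s (l' # ls') js = word_class s (replicate 1 La @ S_word xs) \<and>
    run_value (foldl run_step (q * A_poly l, 1) xs)
      = q * A_poly l * prod_list (map A_poly (l' # ls'))"
  proof (rule Cons.IH)
    show "length ls' = length js" by (rule len)
    show "1 \<le> l'" using Cons.prems(7) ls by auto
    show "js = [] \<Longrightarrow> even (l' + 1)" using Cons.prems(5) ls len by simp
    show "js \<noteq> [] \<Longrightarrow> odd (l' + 1)" using Cons.prems(6) ls len by (auto dest: spec[of _ 0])
    show "js \<noteq> [] \<Longrightarrow> odd (last ls')" using Cons.prems(5) ls len by (cases ls') auto
    show "\<forall>i<length ls' - 1. even (ls' ! i)"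
      using Cons.prems(6) ls by (metis Suc_less_eq Suc_pred diff_Suc_1 length_Cons length_greater_0_conv
          less_nat_zero_code list.size(3) diff_0_eq_0 nth_Cons_Suc)
    show "\<forall>k\<in>set ls'. 0 < k" using Cons.prems(7) ls by simp
    show "\<forall>j\<in>set js. 1 \<le> j \<and> j \<le> s - 1" using Cons.prems(8) by simp
    show "1 \<le> s" by (rule Cons.prems(9))
  qed
  then obtain xs where xs: "set xs \<subseteq> {..<s}"
    "alt_word s ls js = word_class s (La # S_word xs)"
    "run_value (foldl run_step (q * A_poly l, 1) xs) = q * A_poly l * prod_list (map A_poly ls)"
    by (auto simp: ls)
  show ?case
  proof (intro exI conjI)
    show "set (replicate m 0 @ j # xs) \<subseteq> {..<s}" using xs(1) j by auto
    show "alt_word s (l # ls) (j # js)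
        = word_class s (replicate c La @ S_word (replicate m 0 @ j # xs))"
    proof -
      \<comment> \<open>The final \<open>a\<close> of this run is the first letter of \<open>az\<^sup>ja\<close>.\<close>
      have "replicate l La = replicate c La @ replicate (2 * m) La @ [La]"
        by (simp add: m replicate_add replicate_append_same replicate_app_Cons_same)
      then show ?thesis by (simp add: xs(2) word_class_simps S_word_replicate_0)
    qed
    show "run_value (foldl run_step (q, c) (replicate m 0 @ j # xs))
        = q * prod_list (map A_poly (l # ls))"
      using xs(3) j by (simp add: foldl_run_step_replicate_0 m mult.assoc)
  qed
qed

lemma normal_form_S_word:
  assumes "normal_form s \<alpha> ls js" "1 \<le> s"
  obtains xs where "set xs \<subseteq> {..<s}" "\<alpha> = word_class s (S_word xs)"
    "run_poly xs = prod_list (map A_poly ls)"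
proof (cases ls)
  case Nil
  with assms(1) have "\<alpha> = word_class s (S_word [])"
    by (simp add: normal_form_def one_M_monoid)
  then show ?thesis using that[of "[]"] Nil by (simp add: run_poly_Nil)
next
  case (Cons l ks)
  note nf = assms(1)[unfolded normal_form_def]
  have len: "length ks = length js" using nf Cons by simp
  have "\<exists>xs. set xs \<subseteq> {..<s} \<and>
    alt_word s (l # ks) js = word_class s (replicate 0 La @ S_word xs) \<and>
    run_value (foldl run_step (1, 0) xs) = 1 * prod_list (map A_poly (l # ks))"
  proof (rule normal_form_tail)
    show "length ks = length js" by (rule len)
    show "js = [] \<Longrightarrow> even (l + 0)" using nf Cons len by simp
    show "js \<noteq> [] \<Longrightarrow> odd (l + 0)" using nf Cons len by (cases js) auto
    show "js \<noteq> [] \<Longrightarrow> odd (last ks)" using nf Cons len by (cases js; cases ks)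
        (auto simp: last_conv_nth)
    show "\<forall>i<length ks - 1. even (ks ! i)"
    proof (intro allI impI)
      fix i assume "i < length ks - 1"
      then have "1 \<le> Suc i \<and> Suc i < length ls - 1" "length ls \<ge> 2" using Cons by auto
      then have "even (ls ! Suc i)" using nf by blast
      then show "even (ks ! i)" using Cons by simp
    qed
    show "\<forall>k\<in>set ks. 0 < k" "\<forall>j\<in>set js. 1 \<le> j \<and> j \<le> s - 1" using nf Cons by auto
  qed (use assms in auto)
  then show ?thesis using that nf Cons by (auto simp: run_poly_def)
qed

section \<open>Characters\<close>

lemma (in abelian_monoid) finsum_swap:
  assumes "finite I" "finite J" "\<And>i j. i \<in> I \<Longrightarrow> j \<in> J \<Longrightarrow> f i j \<in> carrier G"
  shows "(\<Oplus>i\<in>I. \<Oplus>j\<in>J. f i j) = (\<Oplus>j\<in>J. \<Oplus>i\<in>I. f i j)"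
  using assms(1,3)
proof (induction I rule: finite_induct)
  case empty
  then show ?case by simp
next
  case (insert a I)
  have "(\<Oplus>i\<in>insert a I. \<Oplus>j\<in>J. f i j) = (\<Oplus>j\<in>J. f a j) \<oplus> (\<Oplus>j\<in>J. \<Oplus>i\<in>I. f i j)"
    using insert by (subst finsum_insert) (auto intro!: finsum_closed)
  also have "\<dots> = (\<Oplus>j\<in>J. f a j \<oplus> (\<Oplus>i\<in>I. f i j))"
    using insert by (subst finsum_addf) (auto intro!: finsum_closed)
  also have "\<dots> = (\<Oplus>j\<in>J. \<Oplus>i\<in>insert a I. f i j)"
    using insert by (intro finsum_cong') (auto intro!: finsum_closed)
  finally show ?case .
qed

context unital_cstar_algebra
begin

lemma scal_zero_left: "x \<in> carrier A \<Longrightarrow> scal A 0 x = \<zero>"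
  using scal_add_left[of x 0 0] scal_closed[of x 0] by (metis add.l_cancel_one' add_0)

lemma scal_zero_right: "scal A c \<zero> = \<zero>"
  using scal_scal[of \<zero> c 0] by (simp add: scal_zero_left)

lemma scal_minus_one: 
  assumes "x \<in> carrier A"
  shows "scal A (- 1) x = \<ominus> x"
proof (rule minus_equality[symmetric])
  show "scal A (- 1) x \<oplus> x = \<zero>"
    using scal_add_left[of x "- 1" 1] assms by (simp add: scal_one scal_zero_left)
qed (use assms scal_closed in auto)

lemma scal_finsum:
  assumes "finite I" "\<And>i. i \<in> I \<Longrightarrow> f i \<in> carrier A"
  shows "scal A c (\<Oplus>i\<in>I. f i) = (\<Oplus>i\<in>I. scal A c (f i))"
  using assms
  by (induction I rule: finite_induct)
    (simp_all add: scal_zero_right scal_add_right scal_closed finsum_closed Pi_def)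

lemma finsum_scal:
  assumes "finite I" "x \<in> carrier A"
  shows "(\<Oplus>i\<in>I. scal A (c i) x) = scal A (sum c I) x"
  using assms
  by (induction I rule: finite_induct)
    (simp_all add: scal_zero_left scal_add_left scal_closed Pi_def)

lemma finsum_scal_delta:
  fixes n :: nat
  assumes "j < n" "\<And>k. k < n \<Longrightarrow> f k \<in> carrier A"
  shows "(\<Oplus>k\<in>{..<n}. scal A (if j = k then 1 else 0) (f k)) = f j"
proof -
  have "(\<Oplus>k\<in>{..<n}. scal A (if j = k then 1 else 0) (f k))
      = (\<Oplus>k\<in>{..<n}. if j = k then f k else \<zero>)"
    using assms by (intro finsum_cong') (auto simp: scal_one scal_zero_left)
  also have "\<dots> = f j" using assms finsum_singleton[of j "{..<n}" f] by auto
  finally show ?thesis .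
qed

lemma scal_finsum_scal:
  assumes "finite I" "\<And>i. i \<in> I \<Longrightarrow> f i \<in> carrier A"
  shows "scal A c (\<Oplus>i\<in>I. scal A (d i) (f i)) = (\<Oplus>i\<in>I. scal A (c * d i) (f i))"
  using assms
  by (subst scal_finsum) (auto simp: scal_closed scal_scal intro!: finsum_cong')

text \<open>
  The trace is invariant under conjugation, here for matrices over a noncommutative algebra
  conjugated by scalar matrices: \<open>B\<close> is the inverse of \<open>T\<close>, and both sides compute the trace of
  \<open>BTu = BwT\<close>.
\<close>

lemma trace_conjugate:
  fixes n :: nat
  assumes BT: "\<And>j k. j < n \<Longrightarrow> k < n \<Longrightarrow> (\<Sum>i<n. B j i * T i k) = (if j = k then 1 else 0)"
    and TB: "\<And>i k. i < n \<Longrightarrow> k < n \<Longrightarrow> (\<Sum>j<n. B j i * T k j) = (if i = k then 1 else 0)"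
    and u: "\<And>i j. i < n \<Longrightarrow> j < n \<Longrightarrow> u i j \<in> carrier A"
    and w: "\<And>i j. i < n \<Longrightarrow> j < n \<Longrightarrow> w i j \<in> carrier A"
    and eq: "\<And>i j. i < n \<Longrightarrow> j < n \<Longrightarrow>
      (\<Oplus>k\<in>{..<n}. scal A (T i k) (u k j)) = (\<Oplus>k\<in>{..<n}. scal A (T k j) (w i k))"
  shows "(\<Oplus>i\<in>{..<n}. u i i) = (\<Oplus>i\<in>{..<n}. w i i)"
proof -
  have "(\<Oplus>j\<in>{..<n}. \<Oplus>i\<in>{..<n}. scal A (B j i) (\<Oplus>k\<in>{..<n}. scal A (T i k) (u k j)))
      = (\<Oplus>j\<in>{..<n}. \<Oplus>i\<in>{..<n}. \<Oplus>k\<in>{..<n}. scal A (B j i * T i k) (u k j))"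
    by (intro finsum_cong') (auto simp: scal_closed u intro!: finsum_closed scal_finsum_scal)
  also have "\<dots> = (\<Oplus>j\<in>{..<n}. \<Oplus>k\<in>{..<n}. \<Oplus>i\<in>{..<n}. scal A (B j i * T i k) (u k j))"
    by (intro finsum_cong' finsum_swap) (auto simp: scal_closed u intro!: finsum_closed)
  also have "\<dots> = (\<Oplus>j\<in>{..<n}. \<Oplus>k\<in>{..<n}. scal A (if j = k then 1 else 0) (u k j))"
    by (intro finsum_cong') (auto simp: finsum_scal scal_closed u BT intro!: finsum_closed)
  also have "\<dots> = (\<Oplus>j\<in>{..<n}. u j j)"
    by (intro finsum_cong') (auto simp: u intro!: finsum_scal_delta)
  finally have 1: "(\<Oplus>j\<in>{..<n}. \<Oplus>i\<in>{..<n}. scal A (B j i) (\<Oplus>k\<in>{..<n}. scal A (T i k) (u k j)))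
      = (\<Oplus>j\<in>{..<n}. u j j)" .
  have "(\<Oplus>j\<in>{..<n}. \<Oplus>i\<in>{..<n}. scal A (B j i) (\<Oplus>k\<in>{..<n}. scal A (T i k) (u k j)))
      = (\<Oplus>j\<in>{..<n}. \<Oplus>i\<in>{..<n}. scal A (B j i) (\<Oplus>k\<in>{..<n}. scal A (T k j) (w i k)))"
    by (intro finsum_cong') (auto simp: eq scal_closed w intro!: finsum_closed)
  also have "\<dots> = (\<Oplus>j\<in>{..<n}. \<Oplus>i\<in>{..<n}. \<Oplus>k\<in>{..<n}. scal A (B j i * T k j) (w i k))"
    by (intro finsum_cong') (auto simp: scal_closed w intro!: finsum_closed scal_finsum_scal)
  also have "\<dots> = (\<Oplus>i\<in>{..<n}. \<Oplus>j\<in>{..<n}. \<Oplus>k\<in>{..<n}. scal A (B j i * T k j) (w i k))"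
    by (intro finsum_swap) (auto simp: scal_closed w intro!: finsum_closed)
  also have "\<dots> = (\<Oplus>i\<in>{..<n}. \<Oplus>k\<in>{..<n}. \<Oplus>j\<in>{..<n}. scal A (B j i * T k j) (w i k))"
    by (intro finsum_cong' finsum_swap) (auto simp: scal_closed w intro!: finsum_closed)
  also have "\<dots> = (\<Oplus>i\<in>{..<n}. \<Oplus>k\<in>{..<n}. scal A (if i = k then 1 else 0) (w i k))"
    by (intro finsum_cong') (auto simp: finsum_scal scal_closed w TB intro!: finsum_closed)
  also have "\<dots> = (\<Oplus>i\<in>{..<n}. w i i)"
    by (intro finsum_cong') (auto simp: w intro!: finsum_scal_delta)
  finally show ?thesis using 1 by simp
qed

end

definition amat_closed :: "'a cstar_alg \<Rightarrow> 'a amat \<Rightarrow> bool" where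
  "amat_closed A = (\<lambda>(n, u). \<forall>i<n. \<forall>j<n. u i j \<in> carrier A)"

lemma amat_closed_iff: "amat_closed A (n, u) \<longleftrightarrow> (\<forall>i<n. \<forall>j<n. u i j \<in> carrier A)"
  by (simp add: amat_closed_def)

lemma corep_amat_closed: "corep G u \<Longrightarrow> amat_closed (alg G) u"
  by (auto simp: corep_def amat_closed_def)

lemma corep_char_closed:
  assumes "unital_cstar_algebra A" "amat_closed A u"
  shows "corep_char A u \<in> carrier A"
proof -
  interpret unital_cstar_algebra A by fact
  show ?thesis
    using assms(2) by (cases u) (auto simp: corep_char_def amat_closed_def intro!: finsum_closed)
qed

text \<open>
  The invertible intertwiner is forced to be square, so the two corepresentations have the same
  size and \<open>trace_conjugate\<close> applies.
\<close>

lemma corep_char_equiv: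
  assumes "unital_cstar_algebra (alg G)" "corep_equiv G u w"
  shows "corep_char (alg G) u = corep_char (alg G) w"
proof -
  interpret unital_cstar_algebra "alg G" by fact
  obtain n u' where u: "u = (n, u')" by fastforce
  obtain m w' where w: "w = (m, w')" by fastforce
  obtain T where T: "T \<in> intertwiners (alg G) u w" "invertible_mat T"
    and c: "corep G u" "corep G w"
    using assms(2) by (auto simp: corep_equiv_def)
  have Tc: "T \<in> carrier_mat m n" using T(1) by (simp add: intertwiners_def u w)
  have mn: "m = n" using T(2) Tc by (auto simp: invertible_mat_def)
  obtain B where B: "T * B = 1\<^sub>m n" "B * T = 1\<^sub>m (dim_row B)"
    using T(2) Tc mn by (auto simp: invertible_mat_def inverts_mat_def)
  have Bc: "B \<in> carrier_mat n n"
    using B Tc mn by (metis carrier_matD(2) carrier_matI index_mult_mat(3) index_one_mat(3))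
  \<comment> \<open>Unification cannot recover the matrices \<open>u'\<close> and \<open>w'\<close> from their diagonals alone.\<close>
  have "(\<Oplus>\<^bsub>alg G\<^esub>i\<in>{..<n}. u' i i) = (\<Oplus>\<^bsub>alg G\<^esub>i\<in>{..<n}. w' i i)"
  proof (rule trace_conjugate[where B = "\<lambda>i j. B $$ (i, j)" and T = "\<lambda>i j. T $$ (i, j)"
        and u = u' and w = w'])
    fix j k assume jk: "j < n" "k < n"
    have "(B * T) $$ (j, k) = (\<Sum>i<n. B $$ (j, i) * T $$ (i, k))"
      using jk Bc Tc mn by (auto simp: scalar_prod_def atLeast0LessThan intro!: sum.cong)
    moreover have "B * T = 1\<^sub>m n" using B(2) Bc by simp
    ultimately show "(\<Sum>i<n. B $$ (j, i) * T $$ (i, k)) = (if j = k then 1 else 0)"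
      using jk by simp
    have "(T * B) $$ (k, j) = (\<Sum>i<n. T $$ (k, i) * B $$ (i, j))"
      using jk Bc Tc mn by (auto simp: scalar_prod_def atLeast0LessThan intro!: sum.cong)
    then show "(\<Sum>i<n. B $$ (i, j) * T $$ (k, i)) = (if j = k then 1 else 0)"
      using jk B(1) by (auto simp: mult.commute)
  next
    fix i j assume "i < n" "j < n"
    then show "(\<Oplus>\<^bsub>alg G\<^esub>k\<in>{..<n}. scal (alg G) (T $$ (i, k)) (u' k j))
        = (\<Oplus>\<^bsub>alg G\<^esub>k\<in>{..<n}. scal (alg G) (T $$ (k, j)) (w' i k))"
      using T(1) by (simp add: intertwiners_def u w mn)
  qed (use c in \<open>auto simp: corep_def u w mn\<close>)
  then show ?thesis by (simp add: corep_char_def u w mn)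
qed

lemma lessThan_add_eq: "{..<n + m} = {..<n} \<union> (\<lambda>i. n + i) ` {..<m}" for n m :: nat
proof (intro equalityI subsetI)
  fix x assume x: "x \<in> {..<n + m}"
  show "x \<in> {..<n} \<union> (\<lambda>i. n + i) ` {..<m}"
  proof (cases "x < n")
    case False
    with x have "x = n + (x - n)" "x - n \<in> {..<m}" by auto
    then show ?thesis by blast
  qed simp
qed auto

lemma corep_char_sum:
  assumes "unital_cstar_algebra A" "amat_closed A u" "amat_closed A w"
  shows "corep_char A (corep_sum A u w) = corep_char A u \<oplus>\<^bsub>A\<^esub> corep_char A w"
proof -
  interpret unital_cstar_algebra A by fact
  obtain n u' where u: "u = (n, u')" by fastforce
  obtain m w' where w: "w = (m, w')" by fastforce
  let ?d = "snd (corep_sum A u w)"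
  note un = lessThan_add_eq[of n m]
  have cl: "u' i i \<in> carrier A" if "i < n" for i
    using assms(2) that by (simp add: amat_closed_def u)
  have cl': "w' i i \<in> carrier A" if "i < m" for i
    using assms(3) that by (simp add: amat_closed_def w)
  have "corep_char A (corep_sum A u w) = (\<Oplus>\<^bsub>A\<^esub>i\<in>{..<n + m}. ?d i i)"
    by (simp add: corep_char_def corep_sum_def u w)
  also have "\<dots> = (\<Oplus>\<^bsub>A\<^esub>i\<in>{..<n}. ?d i i) \<oplus>\<^bsub>A\<^esub> (\<Oplus>\<^bsub>A\<^esub>i\<in>(\<lambda>i. n + i) ` {..<m}. ?d i i)"
    unfolding un
    by (rule finsum_Un_disjoint) (auto simp: corep_sum_def u w cl cl')
  also have "(\<Oplus>\<^bsub>A\<^esub>i\<in>(\<lambda>i. n + i) ` {..<m}. ?d i i) = (\<Oplus>\<^bsub>A\<^esub>i\<in>{..<m}. ?d (n + i) (n + i))"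
    by (rule finsum_reindex) (auto simp: corep_sum_def u w cl')
  also have "\<dots> = (\<Oplus>\<^bsub>A\<^esub>i\<in>{..<m}. w' i i)"
    by (rule finsum_cong') (auto simp: corep_sum_def u w cl')
  also have "(\<Oplus>\<^bsub>A\<^esub>i\<in>{..<n}. ?d i i) = (\<Oplus>\<^bsub>A\<^esub>i\<in>{..<n}. u' i i)"
    by (rule finsum_cong') (auto simp: corep_sum_def u w cl)
  finally show ?thesis by (simp add: corep_char_def u w)
qed

lemma corep_char_tensor:
  assumes "unital_cstar_algebra A" "amat_closed A u" "amat_closed A w"
  shows "corep_char A (corep_tensor A u w) = corep_char A u \<otimes>\<^bsub>A\<^esub> corep_char A w"
proof -
  interpret unital_cstar_algebra A by fact
  obtain n u' where u: "u = (n, u')" by fastforce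
  obtain m w' where w: "w = (m, w')" by fastforce
  have cl: "u' i i \<in> carrier A" if "i < n" for i
    using assms(2) that by (simp add: amat_closed_def u)
  have cl': "w' i i \<in> carrier A" if "i < m" for i
    using assms(3) that by (simp add: amat_closed_def w)
  have clw: "(\<Oplus>\<^bsub>A\<^esub>i\<in>{..<m}. w' i i) \<in> carrier A" by (auto intro!: finsum_closed cl')
  have *: "(\<Oplus>\<^bsub>A\<^esub>i\<in>{..<k * m}. u' (i div m) (i div m) \<otimes>\<^bsub>A\<^esub> w' (i mod m) (i mod m))
      = (\<Oplus>\<^bsub>A\<^esub>i\<in>{..<k}. u' i i) \<otimes>\<^bsub>A\<^esub> (\<Oplus>\<^bsub>A\<^esub>i\<in>{..<m}. w' i i)" if "k \<le> n" for k
    using that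
  proof (induction k)
    case 0
    then show ?case using clw by simp
  next
    case (Suc k)
    let ?f = "\<lambda>i. u' (i div m) (i div m) \<otimes>\<^bsub>A\<^esub> w' (i mod m) (i mod m)"
    have un: "{..<Suc k * m} = {..<k * m} \<union> (\<lambda>i. k * m + i) ` {..<m}"
      using lessThan_add_eq[of "k * m" m] by (simp add: add.commute)
    have f: "?f i \<in> carrier A" if "i < Suc k * m" for i
    proof -
      have "m > 0" using that by (cases m) auto
      moreover have "i div m < Suc k" using that by (simp add: less_mult_imp_div_less)
      ultimately show ?thesis using Suc.prems by (auto intro!: cl cl')
    qed
    have fk: "?f (k * m + i) = u' k k \<otimes>\<^bsub>A\<^esub> w' i i" if "i < m" for i
      using that by simp
    have "(\<Oplus>\<^bsub>A\<^esub>i\<in>{..<Suc k * m}. ?f i)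
        = (\<Oplus>\<^bsub>A\<^esub>i\<in>{..<k * m}. ?f i) \<oplus>\<^bsub>A\<^esub> (\<Oplus>\<^bsub>A\<^esub>i\<in>(\<lambda>i. k * m + i) ` {..<m}. ?f i)"
      unfolding un by (rule finsum_Un_disjoint) (auto intro!: f simp del: add_mult_distrib)
    also have "(\<Oplus>\<^bsub>A\<^esub>i\<in>(\<lambda>i. k * m + i) ` {..<m}. ?f i) = (\<Oplus>\<^bsub>A\<^esub>i\<in>{..<m}. ?f (k * m + i))"
      by (rule finsum_reindex) (auto intro!: f)
    also have "\<dots> = (\<Oplus>\<^bsub>A\<^esub>i\<in>{..<m}. u' k k \<otimes>\<^bsub>A\<^esub> w' i i)"
      using Suc.prems by (intro finsum_cong') (auto intro!: cl cl')
    also have "\<dots> = u' k k \<otimes>\<^bsub>A\<^esub> (\<Oplus>\<^bsub>A\<^esub>i\<in>{..<m}. w' i i)"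
      using Suc.prems by (subst finsum_rdistr) (auto intro!: cl cl')
    also have "(\<Oplus>\<^bsub>A\<^esub>i\<in>{..<k * m}. ?f i) = (\<Oplus>\<^bsub>A\<^esub>i\<in>{..<k}. u' i i) \<otimes>\<^bsub>A\<^esub> (\<Oplus>\<^bsub>A\<^esub>i\<in>{..<m}. w' i i)"
      using Suc by simp
    also have "\<dots> \<oplus>\<^bsub>A\<^esub> u' k k \<otimes>\<^bsub>A\<^esub> (\<Oplus>\<^bsub>A\<^esub>i\<in>{..<m}. w' i i)
        = ((\<Oplus>\<^bsub>A\<^esub>i\<in>{..<k}. u' i i) \<oplus>\<^bsub>A\<^esub> u' k k) \<otimes>\<^bsub>A\<^esub> (\<Oplus>\<^bsub>A\<^esub>i\<in>{..<m}. w' i i)"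
      using Suc.prems clw by (subst l_distr) (auto intro!: finsum_closed cl)
    also have "(\<Oplus>\<^bsub>A\<^esub>i\<in>{..<k}. u' i i) \<oplus>\<^bsub>A\<^esub> u' k k = (\<Oplus>\<^bsub>A\<^esub>i\<in>{..<Suc k}. u' i i)"
      using Suc.prems unfolding lessThan_Suc
      by (subst finsum_insert) (auto intro!: finsum_closed cl a_comm)
    finally show ?case .
  qed
  show ?thesis using *[of n] by (simp add: corep_char_def corep_tensor_def u w)
qed

lemma corep_sum_closed:
  assumes "unital_cstar_algebra A" "amat_closed A u" "amat_closed A w"
  shows "amat_closed A (corep_sum A u w)"
proof -
  interpret unital_cstar_algebra A by fact
  show ?thesis using assms(2,3) by (cases u; cases w) (auto simp: corep_sum_def amat_closed_iff)
qed

lemma corep_sum_list_Nil: "corep_sum_list A [] = (0, \<lambda>i j. \<zero>\<^bsub>A\<^esub>)"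
  and corep_sum_list_Cons: "corep_sum_list A (u # us) = corep_sum A u (corep_sum_list A us)"
  by (simp_all add: corep_sum_list_def)

lemma corep_sum_list_closed:
  assumes "unital_cstar_algebra A" "\<forall>u\<in>set us. amat_closed A u"
  shows "amat_closed A (corep_sum_list A us)"
  using assms(2)
  by (induction us)
    (simp_all add: corep_sum_list_Nil corep_sum_list_Cons amat_closed_iff corep_sum_closed[OF assms(1)])

lemma corep_char_sum_list:
  assumes "unital_cstar_algebra A" "\<forall>u\<in>set us. amat_closed A u"
  shows "corep_char A (corep_sum_list A us)
      = foldr (\<lambda>u c. corep_char A u \<oplus>\<^bsub>A\<^esub> c) us \<zero>\<^bsub>A\<^esub>"
proof -
  interpret unital_cstar_algebra A by fact
  have "corep_char A (0, u) = \<zero>\<^bsub>A\<^esub>" for u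
    by (simp add: corep_char_def)
  then show ?thesis
    using assms(2)
    by (induction us)
      (simp_all add: corep_sum_list_Nil corep_sum_list_Cons
        corep_char_sum[OF assms(1)] corep_sum_list_closed[OF assms(1)])
qed

lemma corep_char_trivial:
  assumes "unital_cstar_algebra A"
  shows "corep_char A (trivial_corep A) = \<one>\<^bsub>A\<^esub>"
proof -
  interpret unital_cstar_algebra A by fact
  show ?thesis by (simp add: corep_char_def trivial_corep_def lessThan_Suc)
qed

lemma cstar_subalgebra_generated:
  assumes "unital_cstar_algebra A" "X \<subseteq> carrier A"
  shows "cstar_subalgebra A (cstar_generated A X)"
proof -
  interpret unital_cstar_algebra A by fact
  define F where "F = {B. cstar_subalgebra A B \<and> X \<subseteq> B}"
  have "carrier A \<in> F"
    using assms(2) by (auto simp: F_def cstar_subalgebra_def scal_closed star_closed)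
  then have carr: "\<Inter> F \<subseteq> carrier A" by blast
  have "cstar_subalgebra A B" if "B \<in> F" for B
    using that by (simp add: F_def)
  note sub = this[unfolded cstar_subalgebra_def]
  have "cstar_subalgebra A (\<Inter> F)"
    unfolding cstar_subalgebra_def
  proof (intro conjI ballI allI impI)
    fix X x assume "(\<forall>n. X n \<in> \<Inter> F) \<and> x \<in> carrier A \<and> nrm_tendsto A X x"
    then have "x \<in> B" if "B \<in> F" for B
      using sub[OF that] that by (meson InterD)
    then show "x \<in> \<Inter> F" by blast
  qed (use carr sub in \<open>simp_all\<close>)
  then show ?thesis by (simp add: cstar_generated_def F_def)
qed

section \<open>The image of the characters\<close>

lemma central_alg_subalgebra:
  assumes "unital_cstar_algebra (alg G)"
  shows "cstar_subalgebra (alg G) (central_alg G)"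
  unfolding central_alg_def
  using assms corep_char_closed[OF assms corep_amat_closed]
  by (intro cstar_subalgebra_generated) (auto simp: irreducible_corep_def)

text \<open>
  \<open>y\<close> lies in the central algebra and corresponds to the function \<open>f\<close> of \<open>x\<close> after the substitution
  \<open>X = x\<^sup>2\<close>. Keeping the membership together with the value lets both be carried through the
  induction at once; \<open>\<Phi>\<close> is multiplicative only on the central algebra.
\<close>

definition represents ::
  "real \<Rightarrow> ('a, 'b) quantum_group \<Rightarrow> ('a \<Rightarrow> real \<Rightarrow> complex) \<Rightarrow> 'a \<Rightarrow> (real \<Rightarrow> real) \<Rightarrow> bool" where
  "represents b G \<Phi> y f \<longleftrightarrow> y \<in> central_alg G \<and>
     (\<forall>x. x\<^sup>2 \<in> {0..b} \<longrightarrow> \<Phi> y (x\<^sup>2) = complex_of_real (f x))"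

context
  fixes b :: real and G :: "('a, 'b) quantum_group" and \<Phi> :: "'a \<Rightarrow> real \<Rightarrow> complex"
  assumes G: "unital_cstar_algebra (alg G)"
    and \<Phi>: "\<Phi> \<in> star_hom ((alg G)\<lparr>carrier := central_alg G\<rparr>) (C_interval b)"
begin

lemma represents_one: "represents b G \<Phi> \<one>\<^bsub>alg G\<^esub> (\<lambda>_. 1)"
  using central_alg_subalgebra[OF G] \<Phi>
  by (simp add: represents_def cstar_subalgebra_def star_hom_def ring_hom_def C_interval_def)

lemma represents_add:
  assumes "represents b G \<Phi> y f" "represents b G \<Phi> z g"
  shows "represents b G \<Phi> (y \<oplus>\<^bsub>alg G\<^esub> z) (\<lambda>x. f x + g x)"
  using central_alg_subalgebra[OF G] \<Phi> assms
  by (simp add: represents_def cstar_subalgebra_def star_hom_def ring_hom_def C_interval_def)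

lemma represents_mult:
  assumes "represents b G \<Phi> y f" "represents b G \<Phi> z g"
  shows "represents b G \<Phi> (y \<otimes>\<^bsub>alg G\<^esub> z) (\<lambda>x. f x * g x)"
  using central_alg_subalgebra[OF G] \<Phi> assms
  by (simp add: represents_def cstar_subalgebra_def star_hom_def ring_hom_def C_interval_def)

lemma represents_scal:
  assumes "represents b G \<Phi> y f"
  shows "represents b G \<Phi> (scal (alg G) (complex_of_real c) y) (\<lambda>x. c * f x)"
  using central_alg_subalgebra[OF G] \<Phi> assms
  by (simp add: represents_def cstar_subalgebra_def star_hom_def C_interval_def)

lemma represents_carrier: "represents b G \<Phi> y f \<Longrightarrow> y \<in> carrier (alg G)"
  using central_alg_subalgebra[OF G] by (auto simp: represents_def cstar_subalgebra_def)

lemma represents_zero: "represents b G \<Phi> \<zero>\<^bsub>alg G\<^esub> (\<lambda>_. 0)"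
proof -
  interpret unital_cstar_algebra "alg G" by (rule G)
  show ?thesis
    using represents_scal[OF represents_one, of 0] by (simp add: scal_zero_left)
qed

text \<open>
  Solves \<open>y + z = w\<close> for \<open>y\<close>. This is how a summand of a fusion rule is seen to lie in the
  central algebra, to which \<open>y\<close> is not assumed to belong.
\<close>

lemma represents_cancel:
  assumes "represents b G \<Phi> (y \<oplus>\<^bsub>alg G\<^esub> z) f" "represents b G \<Phi> z g" "y \<in> carrier (alg G)"
  shows "represents b G \<Phi> y (\<lambda>x. f x - g x)"
proof -
  interpret unital_cstar_algebra "alg G" by (rule G)
  have z: "z \<in> carrier (alg G)" using assms(2) by (rule represents_carrier)
  have "y = y \<oplus>\<^bsub>alg G\<^esub> z \<oplus>\<^bsub>alg G\<^esub> scal (alg G) (- 1) z"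
    using z assms(3) by (simp add: scal_minus_one a_assoc r_neg)
  then show ?thesis
    using represents_add[OF assms(1) represents_scal[OF assms(2), of "- 1"]] by simp
qed

end

lemma star_homD:
  assumes "h \<in> star_hom A B"
  shows "h \<in> ring_hom A B" "x \<in> carrier A \<Longrightarrow> h (star A x) = star B (h x)"
  using assms by (auto simp: star_hom_def)

lemma (in monoid) idempotent_pow:
  assumes "x \<in> carrier G" "x \<otimes> x = x" "n > 0"
  shows "x [^] (n :: nat) = x"
  using assms(3)
proof (induction n)
  case (Suc n)
  then show ?case using assms by (cases "n = 0") simp_all
qed simp

text \<open>
  All powers of a projection agree, so the image does not depend on \<open>t\<close>; the separately defined
  case \<open>t = 0\<close> gives \<open>v\<^sub>i\<^sub>iv\<^sub>i\<^sub>i\<^sup>* = v\<^sub>i\<^sub>i\<close> as well.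
\<close>

lemma image_char_U_corep:
  assumes "unital_cstar_algebra A" "unital_cstar_algebra B" "\<pi> \<in> star_hom A B"
    and U: "\<forall>i<N. \<forall>j<N. U i j \<in> carrier A" and v: "\<forall>i<N. \<forall>j<N. v i j \<in> carrier B"
    and \<pi>: "\<forall>i<N. \<forall>j<N. \<pi> (U i j) = v i j" and rel: "permutation_relations N B v"
  shows "\<pi> (corep_char A (U_corep N A U t)) = corep_char B (N, v)"
proof -
  interpret A: unital_cstar_algebra A by fact
  interpret B: unital_cstar_algebra B by fact
  note hom = star_homD[OF assms(3)]
  interpret \<pi>: ring_hom_ring A B \<pi>
    by (rule ring_hom_ringI2[OF A.ring_axioms B.ring_axioms hom(1)])
  let ?d = "\<lambda>i. if t = 0 then U i i \<otimes>\<^bsub>A\<^esub> star A (U i i) else U i i [^]\<^bsub>A\<^esub> t"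
  have "\<pi> (\<Oplus>\<^bsub>A\<^esub>i\<in>{..<N}. ?d i) = (\<Oplus>\<^bsub>B\<^esub>i\<in>{..<N}. \<pi> (?d i))"
    using U by (subst \<pi>.hom_finsum) (auto simp: A.star_closed comp_def)
  also have "\<dots> = (\<Oplus>\<^bsub>B\<^esub>i\<in>{..<N}. v i i)"
  proof (rule B.finsum_cong')
    show "\<pi> (?d i) = v i i" if "i \<in> {..<N}" for i
    proof -
      have vi: "v i i \<in> carrier B" "star B (v i i) = v i i" "v i i \<otimes>\<^bsub>B\<^esub> v i i = v i i"
        using rel v that by (auto simp: permutation_relations_def)
      have Ui: "U i i \<in> carrier A" "\<pi> (U i i) = v i i" using U \<pi> that by auto
      show ?thesis
      proof (cases "t = 0")
        case True
        then show ?thesis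
          using vi Ui hom(2) by (simp add: A.star_closed)
      next
        case False
        then show ?thesis
          using vi Ui by (simp add: \<pi>.hom_nat_pow B.idempotent_pow)
      qed
    qed
  qed (use v in auto)
  finally show ?thesis by (simp add: corep_char_def U_corep_def)
qed

definition word_char ::
  "nat \<Rightarrow> ('a, 'b) quantum_group \<Rightarrow> (letter list set \<Rightarrow> 'a amat) \<Rightarrow> nat list \<Rightarrow> 'a" where
  "word_char s G r xs = corep_char (alg G) (r (word_class s (S_word xs)))"

context
  fixes N s :: nat and G :: "('a, 'b) quantum_group" and U r
  assumes G: "unital_cstar_algebra (alg G)" and r: "irrep_labelling N s G U r"
begin

lemma r_closed: "set xs \<subseteq> {..<s} \<Longrightarrow> amat_closed (alg G) (r (word_class s (S_word xs)))"
  using r S_word_in_S_monoid[of xs s]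
  by (auto simp: irrep_labelling_def irreducible_corep_def intro: corep_amat_closed)

lemma word_char_closed: "set xs \<subseteq> {..<s} \<Longrightarrow> word_char s G r xs \<in> carrier (alg G)"
  unfolding word_char_def by (rule corep_char_closed[OF G r_closed])

lemma word_char_Nil: "word_char s G r [] = \<one>\<^bsub>alg G\<^esub>"
proof -
  have "corep_equiv G (r (word_class s [])) (trivial_corep (alg G))"
    using r by (simp add: irrep_labelling_def one_M_monoid)
  from corep_char_equiv[OF G this] show ?thesis
    by (simp add: word_char_def corep_char_trivial[OF G])
qed

lemma word_char_single:
  assumes "0 < t" "t < s"
  shows "word_char s G r [t] = corep_char (alg G) (U_corep N (alg G) U t)"
proof -
  have "corep_equiv G (r (aza s t)) (U_corep N (alg G) U t)"
    using r assms by (simp add: irrep_labelling_def)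
  from corep_char_equiv[OF G this] show ?thesis
    by (simp add: word_char_def aza_eq)
qed

lemma word_char_zero:
  assumes "0 < s"
  shows "word_char s G r [0] \<oplus>\<^bsub>alg G\<^esub> \<one>\<^bsub>alg G\<^esub> = corep_char (alg G) (U_corep N (alg G) U 0)"
proof -
  interpret unital_cstar_algebra "alg G" by (rule G)
  have "corep_equiv G (corep_sum (alg G) (r (aza s 0)) (trivial_corep (alg G))) (U_corep N (alg G) U 0)"
    using r by (simp add: irrep_labelling_def)
  from corep_char_equiv[OF G this]
  have "corep_char (alg G) (corep_sum (alg G) (r (aza s 0)) (trivial_corep (alg G)))
      = corep_char (alg G) (U_corep N (alg G) U 0)" .
  moreover have "amat_closed (alg G) (trivial_corep (alg G))"
    by (simp add: trivial_corep_def amat_closed_iff)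
  moreover have "amat_closed (alg G) (r (aza s 0))"
    using r_closed[of "[0]"] assms by (simp add: aza_eq)
  ultimately show ?thesis
    by (simp add: corep_char_sum[OF G] corep_char_trivial[OF G] word_char_def aza_eq)
qed

lemma word_char_fusion:
  assumes "set xs \<subseteq> {..<s}" "i < s" "j < s"
  shows "word_char s G r (xs @ [i]) \<otimes>\<^bsub>alg G\<^esub> word_char s G r [j] =
    word_char s G r (xs @ [i, j]) \<oplus>\<^bsub>alg G\<^esub> (word_char s G r (xs @ [(i + j) mod s])
      \<oplus>\<^bsub>alg G\<^esub> (if s dvd i + j then word_char s G r xs else \<zero>\<^bsub>alg G\<^esub>))"
proof -
  interpret unital_cstar_algebra "alg G" by (rule G)
  let ?R = "\<lambda>ys. r (word_class s (S_word ys))"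
  let ?yss = "[xs @ [i, j], xs @ [(i + j) mod s]] @ (if s dvd i + j then [xs] else [])"
  have letters: "set ys \<subseteq> {..<s}" if "ys \<in> set (?yss @ [xs @ [i], [j]])" for ys
    using that assms by (auto split: if_splits)
  have "corep_equiv G (corep_tensor (alg G) (?R (xs @ [i])) (?R [j]))
      (corep_sum_list (alg G) (map ?R ?yss))"
  proof -
    have "fusion s (word_class s (S_word (xs @ [i]))) (word_class s (S_word [j]))
        (map (\<lambda>ys. word_class s (S_word ys)) ?yss)"
      using fusion_S_word_snoc[of s xs i j]
      by (cases "s dvd i + j") (simp_all del: S_word_append S_word_Cons)
    moreover have "word_class s (S_word (xs @ [i])) \<in> S_monoid s" "word_class s (S_word [j]) \<in> S_monoid s"
      using letters by (auto intro!: S_word_in_S_monoid simp del: S_word_append S_word_Cons)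
    ultimately have "corep_equiv G (corep_tensor (alg G) (?R (xs @ [i])) (?R [j]))
        (corep_sum_list (alg G) (map r (map (\<lambda>ys. word_class s (S_word ys)) ?yss)))"
      using r unfolding irrep_labelling_def by blast
    then show ?thesis by (simp only: map_map comp_def)
  qed
  from corep_char_equiv[OF G this]
  have "corep_char (alg G) (?R (xs @ [i])) \<otimes>\<^bsub>alg G\<^esub> corep_char (alg G) (?R [j])
      = corep_char (alg G) (corep_sum_list (alg G) (map ?R ?yss))"
    using letters by (subst corep_char_tensor[OF G, symmetric])
      (auto intro!: r_closed simp del: S_word_append S_word_Cons)
  also have "\<dots> = foldr (\<lambda>u c. corep_char (alg G) u \<oplus>\<^bsub>alg G\<^esub> c) (map ?R ?yss) \<zero>\<^bsub>alg G\<^esub>"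
    using letters by (intro corep_char_sum_list[OF G])
      (auto intro!: r_closed simp del: S_word_append S_word_Cons)
  finally show ?thesis
    using word_char_closed[OF assms(1)]
    by (cases "s dvd i + j") (simp_all add: word_char_def del: S_word_append S_word_Cons)
qed

end

theorem proposition2p1:
  fixes N s :: nat
    and H :: "('a, 'b) quantum_group" and U :: "nat \<Rightarrow> nat \<Rightarrow> 'a"
    and P :: "('c, 'd) quantum_group" and v :: "nat \<Rightarrow> nat \<Rightarrow> 'c"
    and \<pi> :: "'a \<Rightarrow> 'c" and \<Phi> :: "'c \<Rightarrow> real \<Rightarrow> complex"
    and r :: "letter list set \<Rightarrow> 'a amat"
    and \<alpha> :: "letter list set" and ls js :: "nat list"
  assumes "N \<ge> 4" and "s \<ge> 1"
    and "quantum_reflection_group N s H U"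
    and "quantum_permutation_group N P v"
    and "\<pi> \<in> star_hom (alg H) (alg P)" and "\<forall>i<N. \<forall>j<N. \<pi> (U i j) = v i j"
    and "irrep_labelling N s H U r"
    and "central_identification N P v \<Phi>"
    and "\<alpha> \<in> S_monoid s" and "normal_form s \<alpha> ls js"
  shows "\<pi> (corep_char (alg H) (r \<alpha>)) \<in> central_alg P \<and>
         (\<forall>x::real. x\<^sup>2 \<in> {0..real N} \<longrightarrow>
           \<Phi> (\<pi> (corep_char (alg H) (r \<alpha>))) (x\<^sup>2)
             = complex_of_real (\<Prod>i<length ls. poly (A_poly (ls ! i)) x))"
proof -
  have H: "unital_cstar_algebra (alg H)" and U: "\<forall>i<N. \<forall>j<N. U i j \<in> carrier (alg H)"
    using assms(3) by (auto simp: quantum_reflection_group_def universal_cstar_def)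
  have P: "unital_cstar_algebra (alg P)" and v: "\<forall>i<N. \<forall>j<N. v i j \<in> carrier (alg P)"
    and v_rel: "permutation_relations N (alg P) v"
    using assms(4) by (auto simp: quantum_permutation_group_def universal_cstar_def)
  interpret H: unital_cstar_algebra "alg H" by (rule H)
  interpret P: unital_cstar_algebra "alg P" by (rule P)
  have \<Phi>: "\<Phi> \<in> star_hom ((alg P)\<lparr>carrier := central_alg P\<rparr>) (C_interval (real N))"
    using assms(8) by (simp add: central_identification_def star_iso_def)
  have \<pi>: "\<pi> \<in> ring_hom (alg H) (alg P)" using assms(5) by (rule star_homD)
  let ?rep = "represents (real N) P \<Phi>"
  let ?p = "\<lambda>xs. \<pi> (word_char s H r xs)"
  note closed = word_char_closed[OF H assms(7)]
  have \<pi>_closed: "?p xs \<in> carrier (alg P)" if "set xs \<subseteq> {..<s}" for xs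
    using ring_hom_closed[OF \<pi> closed[OF that]] .
  have chi: "?rep (\<pi> (corep_char (alg H) (U_corep N (alg H) U t))) (\<lambda>x. x\<^sup>2)" for t
    using assms(8) image_char_U_corep[OF H P assms(5) U v assms(6) v_rel, of t]
    by (simp add: represents_def central_identification_def)
  have single: "?rep (?p [j]) (poly (run_poly [j]))" if "j < s" for j
  proof (cases "j = 0")
    case True
    have "\<pi> (corep_char (alg H) (U_corep N (alg H) U 0)) = ?p [0] \<oplus>\<^bsub>alg P\<^esub> \<one>\<^bsub>alg P\<^esub>"
      using word_char_zero[OF H assms(7)] ring_hom_add[OF \<pi>, of "word_char s H r [0]" "\<one>\<^bsub>alg H\<^esub>"]
        ring_hom_one[OF \<pi>] closed[of "[0]"] assms(2) by simp
    then have "?rep (?p [0]) (\<lambda>x. x\<^sup>2 - 1)"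
      using chi[of 0] represents_cancel[OF P \<Phi> _ represents_one[OF P \<Phi>]] \<pi>_closed[of "[0]"] assms(2)
      by simp
    then show ?thesis using True by (simp add: poly_run_poly_single represents_def)
  next
    case False
    then show ?thesis
      using chi[of j] word_char_single[OF H assms(7), of j] that
      by (simp add: poly_run_poly_single represents_def)
  qed
  have main: "?rep (?p xs) (poly (run_poly xs))" if "set xs \<subseteq> {..<s}" for xs
    using that
  proof (induction xs rule: length_induct)
    case (1 zs)
    consider "zs = []" | j where "zs = [j]" | xs i j where "zs = xs @ [i, j]"
      by (cases zs rule: rev_cases; cases "butlast zs" rule: rev_cases) auto
    then show ?case
    proof cases
      case 1
      then show ?thesis
        using represents_one[OF P \<Phi>] word_char_Nil[OF H assms(7)] ring_hom_one[OF \<pi>]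
        by (simp add: run_poly_Nil represents_def)
    next
      case 2
      then show ?thesis using single "1.prems" by simp
    next
      case 3
      \<comment> \<open>The fusion rule is solved for the character of \<open>zs\<close>; every other word in it is shorter.\<close>
      let ?k = "(i + j) mod s"
      let ?rest = "\<lambda>x. poly (run_poly (xs @ [?k])) x + (if s dvd i + j then poly (run_poly xs) x else 0)"
      have xs: "set xs \<subseteq> {..<s}" "i < s" "j < s" "?k < s" using "1.prems" 3 by auto
      have IH: "?rep (?p ys) (poly (run_poly ys))" if "set ys \<subseteq> {..<s}" "length ys < length zs" for ys
        using "1.IH" that by blast
      have "\<pi> (word_char s H r (xs @ [i]) \<otimes>\<^bsub>alg H\<^esub> word_char s H r [j]) = ?p (xs @ [i]) \<otimes>\<^bsub>alg P\<^esub> ?p [j]"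
        using xs by (intro ring_hom_mult[OF \<pi>] closed) auto
      then have eq: "?p (xs @ [i]) \<otimes>\<^bsub>alg P\<^esub> ?p [j] = ?p zs \<oplus>\<^bsub>alg P\<^esub>
          (?p (xs @ [?k]) \<oplus>\<^bsub>alg P\<^esub> (if s dvd i + j then ?p xs else \<zero>\<^bsub>alg P\<^esub>))"
        using word_char_fusion[OF H assms(7) xs(1-3)] closed[of zs] closed[of "xs @ [?k]"] closed[of xs]
          "1.prems" xs ring_hom_zero[OF \<pi> H.ring_axioms P.ring_axioms]
        by (simp add: ring_hom_add[OF \<pi>] 3 split: if_splits)
      have "?rep (?p (xs @ [i]) \<otimes>\<^bsub>alg P\<^esub> ?p [j])
          (\<lambda>x. poly (run_poly (xs @ [i])) x * poly (run_poly [j]) x)"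
        using xs 3 by (intro represents_mult[OF P \<Phi>] IH single) auto
      moreover have "?rep (?p (xs @ [?k]) \<oplus>\<^bsub>alg P\<^esub> (if s dvd i + j then ?p xs else \<zero>\<^bsub>alg P\<^esub>)) ?rest"
        using xs 3 IH[of xs] represents_zero[OF P \<Phi>]
        by (intro represents_add[OF P \<Phi>] IH) auto
      ultimately have "?rep (?p zs)
          (\<lambda>x. poly (run_poly (xs @ [i])) x * poly (run_poly [j]) x - ?rest x)"
        unfolding eq using \<pi>_closed[OF "1.prems"] by (rule represents_cancel[OF P \<Phi>])
      then show ?thesis
        using run_poly_recursion[OF xs(2,3), of xs] 3 by (simp add: represents_def)
    qed
  qed
  obtain xs where xs: "set xs \<subseteq> {..<s}" "\<alpha> = word_class s (S_word xs)"
    "run_poly xs = prod_list (map A_poly ls)"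
    using normal_form_S_word[OF assms(10,2)] .
  have "poly (prod_list (map A_poly ls)) x = (\<Prod>i<length ls. poly (A_poly (ls ! i)) x)" for x
    by (simp add: prod.list_conv_set_nth poly_prod atLeast0LessThan)
  then show ?thesis
    using main[OF xs(1)] by (simp add: represents_def word_char_def xs(2,3))
qed

end
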